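(* Let $a_j,b_j\in\mathbb{R}$, $j=1,\dots,r$, set $a=\sum_{j=1}^ra_j$, and consider the splitting integrator $$\widetilde\phi_h=\phi^{(P)}_{b_rh}\circ\phi^{(U)}_{a_rh}\circ\cdots\circ\phi^{(P)}_{b_1h}\circ\phi^{(U)}_{a_1h},$$ where $\phi^{(U)}_t$ and $\phi^{(P)}_t$ are the exact $t$-flows of $\frac{d}{dt}(y,\theta)=(0,\omega)$ and of $\frac{d}{dt}(y,\theta)=f(y,\theta)$ respectively. Then $\widetilde\phi_h$ possesses the (formal) expansion $$\widetilde\phi_h(x)=\overline{W}_{(ha\omega,\widetilde\alpha(h))}(x),$$ where $\widetilde\alpha(h)\in\mathcal{G}$ is specified by $\widetilde\alpha_\emptyset(h)=1$ and, for $n=1,2,\dots$ and $\mathbf{k}_1,\dots,\mathbf{k}_n\in\mathbb{Z}^d$, $$\widetilde\alpha_{\mathbf{k}_1\cdots\mathbf{k}_n}(h)=h^n\sum_{1\le j_1\le\cdots\le j_n\le r}\frac{b_{j_1}\cdots b_{j_n}}{\sigma_{j_1\cdots j_n}}\exp\big(i(c_{j_1}\mathbf{k}_1+\cdots+c_{j_n}\mathbf{k}_n)\cdot\omega h\big).$$ Here $c_j=a_1+\cdots+a_j$ for $1\le j\le r$, and $$\sigma_{j_1\cdots j_n}=n!\quad\text{if } j_1=\cdots=j_n,$$ $$\sigma_{j_1\cdots j_n}=\ell!\,\sigma_{j_{\ell+1}\cdots j_n}\quad\text{if } \ell<n,\ j_1=\cdots=j_\ell<j_{\ell+1}\le\cdots\le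 j_n.$$
   Context: **Setting.** Let $0<d\le D$ be integers and $x=(y,\theta)$ with $y\in\mathbb{R}^{D-d}$ and $\theta\in\mathbb{R}^d$ a vector of angles; $\omega\in\mathbb{R}^d$ has components $\omega_j>0$. The perturbation $f(y,\theta)=\sum_{\mathbf{k}\in\mathbb{Z}^d}f_{\mathbf{k}}(y,\theta)$ is smooth, $\mathbb{R}^D$-valued and $2\pi$-periodic in each component of $\theta$, with $f_{\mathbf{k}}(y,\theta)=\exp(i\mathbf{k}\cdot\theta)\hat f_{\mathbf{k}}(y)$, where the $\hat f_{\mathbf{k}}$ are $\mathbb{C}^D$-valued Fourier coefficients ($\hat f_{-\mathbf{k}}$ is the complex conjugate of $\hat f_{\mathbf{k}}$). The system being integrated is $\frac{d}{dt}(y,\theta)=(0,\omega)+f(y,\theta)$. **Words and series.** $\mathcal{W}$ is the set of words $\mathbf{k}_1\cdots\mathbf{k}_n$, $n\ge0$, over the alphabet $\mathbb{Z}^d$; $\emptyset$ is the empty word. $\mathbb{C}^{\mathcal{W}}$ is the vector space of maps $\delta:\mathcal{W}\to\mathbb{C}$, $w\mapsto\delta_w$. The word-basis functions are $f_\emptyset(x)=x$, $f_{\mathbf{k}}(x)=f_{\mathbf{k}}(y,\theta)=\exp(i\mathbf{k}\cdot\theta)\hat f_{\mathbf{k}}(y)$ for one letter, and $f_{\mathbf{k}_1\cdots\mathbf{k}_n}(x)=\big(\partial_xf_{\mathbf{k}_2\cdots\mathbf{k}_n}(x)\big)f_{\mathbf{k}_1}(x)$ for $n>1$ ($\partial_x$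 is the Jacobian with respect to $x=(y,\theta)$). For $(v,\delta)\in\mathbb{C}^d\oplus\mathbb{C}^{\mathcal{W}}$ the extended word series is the formal series $\overline{W}_{(v,\delta)}(x)=\begin{bmatrix}0\\ v\end{bmatrix}+\sum_{w\in\mathcal{W}}\delta_wf_w(x)$. **Group.** The shuffle product of words of lengths $m,n$ is the formal sum $\sum_{j=1}^Nw_j$ (with multiplicity, $N=(m+n)!/(m!n!)$) of all interleavings of the two words preserving the order of the letters in each; shuffling with $\emptyset$ leaves a word unchanged. $\mathcal{G}$ is the set of $\gamma\in\mathbb{C}^{\mathcal{W}}$ with $\gamma_\emptyset=1$ and $\gamma_w\gamma_{w'}=\sum_j\gamma_{w_j}$ whenever the shuffle of $w,w'$ is $\sum_jw_j$. **Formal meaning.** Expansions are formal: with $\epsilon f_{\mathbf{k}}$ in place of $f_{\mathbf{k}}$ they are formal power series in $\epsilon$, words with $n$ letters contributing to $\epsilon^n$ (the sum over the infinitely many words of $n$ letters is itself formal). The exact flows of the split systems have the expansions $\phi^{(U)}_t(x)=\overline{W}_{(t\omega,\mathbf{1})}(x)$, where $\mathbf{1}_\emptyset=1$, $\mathbf{1}_w=0$ for $w\neq\emptyset$, and $\phi^{(P)}_t(x)=\overline{W}_{(0,\tau(t))}(x)$, where $\tau_w(t)=t^n/n!$ if $w$ has $n$ letters (Taylor expansion). Composition of extended word series is by formal substitution: for $\gamma\in\mathcal{G}$, $\overline{W}_{(v,\delta)}(\overline{W}_{(u,\gamma)}(x))=\overline{W}_{(u,\gamma)\bigstar(v,\delta)}(x)$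 with $(u,\gamma)\bigstar(v,\delta)=(\gamma_\emptyset v+\delta_\emptyset u,\ \gamma\star(\Xi_u\delta))$, where $(\Xi_u\delta)_{\mathbf{k}_1\cdots\mathbf{k}_n}=\exp(i(\mathbf{k}_1+\cdots+\mathbf{k}_n)\cdot u)\delta_{\mathbf{k}_1\cdots\mathbf{k}_n}$, $(\Xi_u\delta)_\emptyset=\delta_\emptyset$, and $\star$ is the convolution product $(\delta\star\delta')_{w}=\sum_{w=w'w''}\delta_{w'}\delta'_{w''}$ (sum over all $n+1$ deconcatenations of the $n$-letter word $w$, including those with an empty factor). *)

theory Defs
  imports "HOL-Analysis.Analysis" "HOL-Library.Multiset"
begin

text \<open>
  The state \<open>x = (y, \<theta>)\<close> is a vector in \<open>real ^ 'n\<close> (so \<open>D = CARD('n)\<close>), and an injection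
  \<open>\<iota> :: 'd \<Rightarrow> 'n\<close> says which coordinates are the angles \<open>\<theta>\<close> (so \<open>d = CARD('d)\<close> and
  \<open>0 < d \<le> D\<close>); the remaining coordinates form \<open>y\<close>.  A product type \<open>real ^ 'm \<times> real ^ 'd\<close>
  would exclude the case \<open>d = D\<close>.
\<close>

definition angles :: "('d::finite \<Rightarrow> 'n::finite) \<Rightarrow> real ^ 'n \<Rightarrow> real ^ 'd" where
  "angles \<iota> x = (\<chi> j. x $ \<iota> j)"

definition with_angles :: "('d::finite \<Rightarrow> 'n::finite) \<Rightarrow> real ^ 'n \<Rightarrow> real ^ 'd \<Rightarrow> real ^ 'n" where
  "with_angles \<iota> x \<theta> = (\<chi> i. if i \<in> range \<iota> then \<theta> $ inv \<iota> i else x $ i)"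

text \<open>The vector \<open>(0, v)\<close>.\<close>

definition angle_embed :: "('d::finite \<Rightarrow> 'n::finite) \<Rightarrow> complex ^ 'd \<Rightarrow> complex ^ 'n" where
  "angle_embed \<iota> v = (\<chi> i. if i \<in> range \<iota> then v $ inv \<iota> i else 0)"

definition cvec :: "real ^ 'n \<Rightarrow> complex ^ 'n" where
  "cvec x = (\<chi> i. complex_of_real (x $ i))"

definition Re_vec :: "complex ^ 'n \<Rightarrow> real ^ 'n" where
  "Re_vec z = (\<chi> i. Re (z $ i))"

definition idot :: "int ^ 'd::finite \<Rightarrow> real ^ 'd \<Rightarrow> real" where
  "idot k \<theta> = (\<Sum>j\<in>UNIV. real_of_int (k $ j) * \<theta> $ j)"


definition partial :: "'n::finite \<Rightarrow> (real ^ 'n \<Rightarrow> 'b::real_normed_vector) \<Rightarrow> real ^ 'n \<Rightarrow> 'b" where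
  "partial i F x = frechet_derivative F (at x) (axis i 1)"

primrec partials :: "'n::finite list \<Rightarrow> (real ^ 'n \<Rightarrow> 'b::real_normed_vector) \<Rightarrow> real ^ 'n \<Rightarrow> 'b" where
  "partials [] F = F"
| "partials (i # is) F = partial i (partials is F)"

text \<open>Differentiability of all iterated partial derivatives is the same as being \<open>C\<^sup>\<infinity>\<close>.\<close>

definition smooth_map :: "(real ^ 'n::finite \<Rightarrow> 'b::real_normed_vector) \<Rightarrow> bool" where
  "smooth_map F \<longleftrightarrow> (\<forall>is x. partials is F differentiable (at x))"

definition angle_periodic :: "('d::finite \<Rightarrow> 'n::finite) \<Rightarrow> (real ^ 'n \<Rightarrow> 'b) \<Rightarrow> bool" where
  "angle_periodic \<iota> f \<longleftrightarrow> (\<forall>j x. f (x + (2 * pi) *\<^sub>R axis (\<iota> j) 1) = f x)"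

text \<open>
  The Fourier coefficient takes the whole state as argument, but depends only on its
  \<open>y\<close>-part, since the angles are integrated out.
\<close>

definition fourier_coeff ::
  "('d::finite \<Rightarrow> 'n::finite) \<Rightarrow> (real ^ 'n \<Rightarrow> real ^ 'n) \<Rightarrow> int ^ 'd \<Rightarrow> real ^ 'n \<Rightarrow> complex ^ 'n" where
  "fourier_coeff \<iota> f k x =
     (1 / (2 * pi) ^ CARD('d)) *\<^sub>R
       integral (cbox 0 (\<chi> j. 2 * pi))
         (\<lambda>\<theta>. exp (- \<i> * complex_of_real (idot k \<theta>)) *s cvec (f (with_angles \<iota> x \<theta>)))"

definition fourier_mode ::
  "('d::finite \<Rightarrow> 'n::finite) \<Rightarrow> (real ^ 'n \<Rightarrow> real ^ 'n) \<Rightarrow> int ^ 'd \<Rightarrow> real ^ 'n \<Rightarrow> complex ^ 'n" where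
  "fourier_mode \<iota> f k x =
     exp (\<i> * complex_of_real (idot k (angles \<iota> x))) *s fourier_coeff \<iota> f k x"


type_synonym 'd word = "(int ^ 'd) list"

text \<open>In the last equation the sum over \<open>i\<close> is the Jacobian applied to a complex vector.\<close>

fun word_basis ::
  "('d::finite \<Rightarrow> 'n::finite) \<Rightarrow> (real ^ 'n \<Rightarrow> real ^ 'n) \<Rightarrow> 'd word \<Rightarrow> real ^ 'n \<Rightarrow> complex ^ 'n" where
  "word_basis \<iota> f [] = cvec"
| "word_basis \<iota> f [k] = fourier_mode \<iota> f k"
| "word_basis \<iota> f (k # l # w) =
     (\<lambda>x. \<Sum>i\<in>UNIV. (fourier_mode \<iota> f k x $ i) *s partial i (word_basis \<iota> f (l # w)) x)"

text \<open>The library's \<open>shuffles\<close> is a set; here multiplicities matter.\<close>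

fun shuffle_mset :: "'a list \<Rightarrow> 'a list \<Rightarrow> 'a list multiset" where
  "shuffle_mset [] v = {#v#}"
| "shuffle_mset u [] = {#u#}"
| "shuffle_mset (x # u) (y # v) =
     image_mset ((#) x) (shuffle_mset u (y # v)) + image_mset ((#) y) (shuffle_mset (x # u) v)"

definition word_group :: "('a list \<Rightarrow> complex) set" where
  "word_group = {\<gamma>. \<gamma> [] = 1 \<and> (\<forall>u v. \<gamma> u * \<gamma> v = (\<Sum>w\<in>#shuffle_mset u v. \<gamma> w))}"


text \<open>
  Formal maps.  Each Fourier mode \<open>f\<^sub>k\<close> is marked by its own indeterminate \<open>\<lambda>\<^sub>k\<close>, i.e. \<open>f\<close> is
  replaced by the formal sum of the \<open>\<lambda>\<^sub>k f\<^sub>k\<close>.  A formal map is a formal power series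
  in the \<open>\<lambda>\<^sub>k\<close>; monomials are finite multisets of letters, and \<open>\<Phi> m x\<close> is the coefficient of
  the monomial \<open>m\<close> at the point \<open>x\<close>.  Putting \<open>\<lambda>\<^sub>k = \<epsilon>\<close> collects the monomials of
  size \<open>n\<close>, that is the words with \<open>n\<close> letters, into the coefficient of \<open>\<epsilon>\<^sup>n\<close>.  Keeping the
  \<open>\<lambda>\<^sub>k\<close> apart makes the sum over the infinitely many words with \<open>n\<close> letters formal: only
  finitely many words contribute to each monomial.
\<close>

type_synonym ('d, 'n) formal_map = "(int ^ 'd) multiset \<Rightarrow> real ^ 'n \<Rightarrow> complex ^ 'n"

definition formal_id :: "('d::finite, 'n::finite) formal_map" where
  "formal_id m x = (if m = {#} then cvec x else 0)"

definition ext_word_series ::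
  "('d::finite \<Rightarrow> 'n::finite) \<Rightarrow> (real ^ 'n \<Rightarrow> real ^ 'n) \<Rightarrow>
   complex ^ 'd \<Rightarrow> ('d word \<Rightarrow> complex) \<Rightarrow> ('d, 'n) formal_map" where
  "ext_word_series \<iota> f v \<delta> m x =
     (if m = {#} then angle_embed \<iota> v else 0) + (\<Sum>w | mset w = m. \<delta> w *s word_basis \<iota> f w x)"

text \<open>
  Formal substitution of \<open>\<Phi>\<close> into \<open>\<Psi>\<close>: every coefficient of \<open>\<Psi>\<close> is expanded in its Taylor series
  at \<open>z = \<Phi> {#} x\<close>,
  \[ \Psi_{m_0}(\Phi(x)) = \sum_{s} \frac{1}{s!}\, D^s\Psi_{m_0}(z)[\Delta, \ldots, \Delta],
     \qquad \Delta = \sum_{p \neq \{\#\}} \Phi_p(x)\, \lambda^p , \]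
  with the derivatives extended to complex multilinear maps, and the coefficient of each
  monomial is collected.  The coefficients of \<open>\<Psi>\<close> are functions of a real variable, so this is
  meaningful only if \<open>\<Phi> {#} x\<close> is a real vector; then \<open>Re_vec\<close> is a mere change of type.
\<close>

definition formal_comp ::
  "('d::finite, 'n::finite) formal_map \<Rightarrow> ('d, 'n) formal_map \<Rightarrow> ('d, 'n) formal_map"
    (infixr "\<odot>" 55) where
  "(\<Psi> \<odot> \<Phi>) m x =
     (\<Sum>(m0, ps) | {#} \<notin> set ps \<and> m0 + sum_list ps = m.
        \<Sum>is | length is = length ps.
          (prod_list (map2 (\<lambda>p i. \<Phi> p x $ i) ps is) / fact (length ps)) *s
            partials is (\<Psi> m0) (Re_vec (\<Phi> {#} x)))"

definition formal_flow ::
  "('d::finite, 'n::finite) formal_map \<Rightarrow> (real \<Rightarrow> ('d, 'n) formal_map) \<Rightarrow> bool" where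
  "formal_flow V \<Phi> \<longleftrightarrow> \<Phi> 0 = formal_id \<and>
     (\<forall>t m x. ((\<lambda>s. \<Phi> s m x) has_vector_derivative (V \<odot> \<Phi> t) m x) (at t))"

definition rotation_field ::
  "('d::finite \<Rightarrow> 'n::finite) \<Rightarrow> real ^ 'd \<Rightarrow> ('d, 'n) formal_map" where
  "rotation_field \<iota> \<omega> m x = (if m = {#} then angle_embed \<iota> (cvec \<omega>) else 0)"

text \<open>The sum over \<open>m\<close> has a single term: this is the formal sum of the \<open>\<lambda>\<^sub>k f\<^sub>k\<close>.\<close>

definition perturbation_field ::
  "('d::finite \<Rightarrow> 'n::finite) \<Rightarrow> (real ^ 'n \<Rightarrow> real ^ 'n) \<Rightarrow> ('d, 'n) formal_map" where
  "perturbation_field \<iota> f m x = (if size m = 1 then \<Sum>k\<in>#m. fourier_mode \<iota> f k x else 0)"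

primrec splitting_integrator ::
  "(real \<Rightarrow> ('d::finite, 'n::finite) formal_map) \<Rightarrow> (real \<Rightarrow> ('d, 'n) formal_map) \<Rightarrow>
   (nat \<Rightarrow> real) \<Rightarrow> (nat \<Rightarrow> real) \<Rightarrow> real \<Rightarrow> nat \<Rightarrow> ('d, 'n) formal_map" where
  "splitting_integrator \<Phi>U \<Phi>P a b h 0 = formal_id"
| "splitting_integrator \<Phi>U \<Phi>P a b h (Suc r) =
     \<Phi>P (b (Suc r) * h) \<odot> \<Phi>U (a (Suc r) * h) \<odot> splitting_integrator \<Phi>U \<Phi>P a b h r"


text \<open>The value at the empty list makes the case of \<open>n\<close> equal indices give \<open>n!\<close>.\<close>

function sigma :: "nat list \<Rightarrow> nat" where
  "sigma [] = 1"
| "sigma (j # js) =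
     fact (length (takeWhile ((=) j) (j # js))) * sigma (dropWhile ((=) j) (j # js))"
  by pat_completeness auto
termination
  by (relation "Wellfounded.measure length") (auto simp: less_Suc_eq_le length_dropWhile_le)

definition alpha_tilde ::
  "real ^ 'd::finite \<Rightarrow> (nat \<Rightarrow> real) \<Rightarrow> (nat \<Rightarrow> real) \<Rightarrow> nat \<Rightarrow> real \<Rightarrow> 'd word \<Rightarrow> complex" where
  "alpha_tilde \<omega> a b r h ks =
     (let n = length ks; c = (\<lambda>j. \<Sum>i = 1..j. a i) in
      if n = 0 then 1
      else complex_of_real (h ^ n) *
        (\<Sum>js | length js = n \<and> sorted js \<and> set js \<subseteq> {1..r}.
           complex_of_real ((\<Prod>l<n. b (js ! l)) / real (sigma js)) *
           exp (\<i> * complex_of_real ((\<Sum>l<n. c (js ! l) * idot (ks ! l) \<omega>) * h))))"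

end

theory Submission
  imports Defs
begin

text \<open>
  A letter \<open>k\<close> acts on functions as the derivation \<open>F \<mapsto> \<Sum>\<^sub>i f\<^sub>k\<^sub>,\<^sub>i \<partial>\<^sub>i F\<close> and a word as the composite of
  its letters, so that the word-basis function of \<open>w\<close> is \<open>w\<close> applied to the coordinates.  Applied to
  a product, a word distributes its letters over the factors.  If \<open>\<gamma>\<close> satisfies the shuffle relations,
  the operator \<open>\<Sum>\<^sub>w \<gamma>\<^sub>w w\<close> is therefore multiplicative, and a multiplicative differential operator is a
  substitution: it sends every smooth \<open>F\<close> to the Taylor expansion of \<open>F\<close> about \<open>x\<close> at the point to
  which the word series of \<open>\<gamma>\<close> moves \<open>x\<close>.  This is \<open>taylor_substitution\<close>.  It rests on an expansion of
  the operator of a single word in partial derivatives of \<open>F\<close> (\<open>word_op_expansion\<close>), where the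
  symmetry of partial derivatives enters, and on the shuffle relations (\<open>sum_block_sum\<close>).

  Operators of words compose by concatenation, and a rotation by \<open>u\<close> multiplies the mode \<open>f\<^sub>k\<close> by
  \<open>exp (i k \<cdot> u)\<close>.  Substitution of one extended word series into another is therefore convolution of
  the coefficients, twisted by these phases (\<open>ext_word_series_comp\<close>).

  Both split vector fields are themselves extended word series, so the composition rule also
  verifies that the expected series solve the flow equations.  They are the only solutions, because
  the equation for the coefficient of a monomial involves that of smaller monomials only
  (\<open>formal_flow_unique\<close>).  Hence the coefficients of the integrator are an iterated convolution of
  twisted exponentials \<open>t\<^sup>n / n!\<close>.  They lie in the group because convolution, twist and exponential
  respect the shuffle relations.  Expanding the convolution cuts a word into \<open>r\<close> consecutive pieces,
  one for each step.  Such a cut is a non-decreasing list of indices, and the factorials of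
  the lengths of the pieces multiply to \<open>\<sigma>\<close> (\<open>splitting_coeff_eq\<close>).
\<close>

section \<open>Smooth functions and iterated partial derivatives\<close>

lemma partial_eqI: "(F has_derivative F') (at x) \<Longrightarrow> partial i F x = F' (axis i 1)"
  by (simp add: partial_def frechet_derivative_at[symmetric])

lemma has_derivative_partial:
  fixes F :: "real ^ 'n::finite \<Rightarrow> 'b::real_normed_vector"
  assumes "F differentiable at x"
  shows "(F has_derivative (\<lambda>h. \<Sum>i\<in>UNIV. h $ i *\<^sub>R partial i F x)) (at x)"
proof -
  obtain F' where F': "(F has_derivative F') (at x)"
    using assms by (auto simp: differentiable_def)
  interpret bounded_linear F' by (rule has_derivative_bounded_linear[OF F'])
  have "F' h = (\<Sum>i\<in>UNIV. h $ i *\<^sub>R partial i F x)" for h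
  proof -
    have "F' h = F' (\<Sum>i\<in>UNIV. h $ i *\<^sub>R axis i 1)"
      using basis_expansion[of h] by (simp add: scalar_mult_eq_scaleR)
    then show ?thesis by (simp add: sum scaleR partial_eqI[OF F'])
  qed
  then have "F' = (\<lambda>h. \<Sum>i\<in>UNIV. h $ i *\<^sub>R partial i F x)" by blast
  with F' show ?thesis by simp
qed

lemma partials_append: "partials (us @ vs) F = partials us (partials vs F)"
  by (induction us) auto

lemma smooth_mapD:
  assumes "smooth_map F"
  shows smooth_map_differentiable: "F differentiable at x"
    and smooth_map_partial: "smooth_map (partial i F)"
    and smooth_map_partials: "smooth_map (partials us F)"
proof -
  show "F differentiable at x"
    using assms unfolding smooth_map_def by (metis partials.simps(1))
  show "smooth_map (partials us F)" for us
    using assms unfolding smooth_map_def by (metis partials_append)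
  from this[of "[i]"] show "smooth_map (partial i F)" by simp
qed

text \<open>
  Smoothness is the greatest property that implies differentiability and passes to the partial
  derivatives, so a class of functions closed under partial derivatives proves its members
  smooth all at once.
\<close>

lemma smooth_map_coinduct:
  assumes "P F"
    and "\<And>F x. P F \<Longrightarrow> F differentiable at x"
    and "\<And>F i. P F \<Longrightarrow> P (partial i F)"
  shows "smooth_map F"
proof -
  have "P (partials us F)" for us using assms by (induction us) auto
  then show ?thesis using assms(2) by (auto simp: smooth_map_def)
qed

lemma partial_const [simp]: "partial i (\<lambda>x. c) = (\<lambda>x. 0)"
  by (rule ext, rule partial_eqI[THEN trans]) auto

lemma smooth_map_const: "smooth_map (\<lambda>x. c)"
  by (rule smooth_map_coinduct[where P="\<lambda>F. \<exists>c. F = (\<lambda>x. c)"]) auto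

lemma partials_zero: "partials us (\<lambda>x. 0) = (\<lambda>x. 0)"
  by (induction us) auto

lemma partials_const: "us \<noteq> [] \<Longrightarrow> partials us (\<lambda>x. c) = (\<lambda>x. 0)"
  by (cases us rule: rev_cases) (auto simp: partials_append partials_zero)

lemma partial_add:
  assumes "F differentiable at x" "G differentiable at x"
  shows "partial i (\<lambda>x. F x + G x) x = partial i F x + partial i G x"
  using has_derivative_add[OF assms[THEN frechet_derivative_works[THEN iffD1]]]
  by (rule partial_eqI[THEN trans]) (simp add: partial_def)

lemma partial_mult:
  fixes F G :: "real ^ 'n::finite \<Rightarrow> 'b::real_normed_algebra"
  assumes "F differentiable at x" "G differentiable at x"
  shows "partial i (\<lambda>x. F x * G x) x = partial i F x * G x + F x * partial i G x"
  using has_derivative_mult[OF assms[THEN frechet_derivative_works[THEN iffD1]]]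
  by (rule partial_eqI[THEN trans]) (simp add: partial_def)

lemma partial_linear:
  assumes "bounded_linear L" "F differentiable at x"
  shows "partial i (\<lambda>x. L (F x)) x = L (partial i F x)"
  using bounded_linear.has_derivative[OF assms(1) assms(2)[THEN frechet_derivative_works[THEN iffD1]]]
  by (rule partial_eqI[THEN trans]) (simp add: partial_def)

lemma partials_linear:
  assumes "bounded_linear L" "smooth_map F"
  shows "partials us (\<lambda>x. L (F x)) = (\<lambda>x. L (partials us F x))"
  by (induction us)
    (auto intro!: ext partial_linear assms smooth_map_differentiable smooth_map_partials)

lemma smooth_map_linear:
  assumes "bounded_linear L" "smooth_map F"
  shows "smooth_map (\<lambda>x. L (F x))"
  unfolding smooth_map_def partials_linear[OF assms]
  using assms bounded_linear_imp_differentiable[OF assms(1)]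
  by (metis differentiable_compose smooth_map_differentiable smooth_map_partials)

lemma smooth_map_add:
  fixes F G :: "real ^ 'n::finite \<Rightarrow> 'b::real_normed_vector"
  assumes "smooth_map F" "smooth_map G"
  shows "smooth_map (\<lambda>x. F x + G x)"
proof (rule smooth_map_coinduct
    [where P="\<lambda>H. \<exists>F G. smooth_map F \<and> smooth_map G \<and> H = (\<lambda>x. F x + G x)"])
  show "\<exists>F' G'. smooth_map F' \<and> smooth_map G' \<and> partial i H = (\<lambda>x. F' x + G' x)"
    if H: "\<exists>F G. smooth_map F \<and> smooth_map G \<and> H = (\<lambda>x. F x + G x)" for H :: "real ^ 'n \<Rightarrow> 'b" and i
  proof -
    obtain F G where FG: "smooth_map F" "smooth_map G" "H = (\<lambda>x. F x + G x)"
      using H by blast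
    then have "partial i H = (\<lambda>x. partial i F x + partial i G x)"
      by (auto intro!: ext partial_add smooth_map_differentiable)
    with FG show ?thesis by (blast intro: smooth_map_partial)
  qed
qed (use assms in \<open>auto intro!: differentiable_add intro: smooth_map_differentiable\<close>)

lemma smooth_map_sum:
  "finite A \<Longrightarrow> (\<And>a. a \<in> A \<Longrightarrow> smooth_map (F a)) \<Longrightarrow> smooth_map (\<lambda>x. \<Sum>a\<in>A. F a x)"
  by (induction A rule: finite_induct) (auto intro: smooth_map_const smooth_map_add)

text \<open>
  A partial derivative of a product is a sum of two products, so the class that is closed under
  partial derivatives consists of the finite sums of products of smooth functions.
\<close>

lemma smooth_map_mult:
  fixes F G :: "real ^ 'n::finite \<Rightarrow> 'b::real_normed_algebra"
  assumes "smooth_map F" "smooth_map G"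
  shows "smooth_map (\<lambda>x. F x * G x)"
proof -
  define V where "V L = (\<lambda>x. \<Sum>(F, G)\<leftarrow>L. F x * G x)"
    for L :: "((real ^ 'n \<Rightarrow> 'b) \<times> (real ^ 'n \<Rightarrow> 'b)) list"
  define ok where "ok L \<longleftrightarrow> (\<forall>(F, G)\<in>set L. smooth_map F \<and> smooth_map G)"
    for L :: "((real ^ 'n \<Rightarrow> 'b) \<times> (real ^ 'n \<Rightarrow> 'b)) list"
  have diff: "V L differentiable at x" if "ok L" for L x
    using that
    by (induction L) (auto simp: V_def ok_def intro!: differentiable_add differentiable_mult
        intro: smooth_map_differentiable)
  have deriv: "\<exists>L'. ok L' \<and> partial i (V L) = V L'" if "ok L" for L i
    using that
  proof (induction L)
    case Nil
    then show ?case by (intro exI[of _ "[]"]) (simp add: V_def)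
  next
    case (Cons FG L)
    obtain F G where FG: "FG = (F, G)" by force
    from Cons obtain L' where L': "ok L'" "partial i (V L) = V L'"
      by (auto simp: ok_def)
    have s: "smooth_map F" "smooth_map G" "ok L"
      using Cons.prems by (auto simp: ok_def FG)
    have "V (FG # L) = (\<lambda>x. F x * G x + V L x)" by (simp add: V_def FG)
    then have "partial i (V (FG # L)) = V ((partial i F, G) # (F, partial i G) # L')"
      using s L'(2) diff[OF s(3)]
      by (auto simp: partial_add partial_mult smooth_map_differentiable differentiable_mult V_def
          intro!: ext)
    then show ?case
      using s L' by (intro exI[of _ "(partial i F, G) # (F, partial i G) # L'"])
        (auto simp: ok_def smooth_map_partial)
  qed
  show ?thesis
  proof (rule smooth_map_coinduct[where P="\<lambda>H. \<exists>L. ok L \<and> H = V L"])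
    show "\<exists>L. ok L \<and> (\<lambda>x. F x * G x) = V L"
      using assms by (intro exI[of _ "[(F, G)]"]) (auto simp: ok_def V_def)
  qed (use diff deriv in auto)
qed

lemma partial_id: "partial i (\<lambda>x. x) x = axis i 1"
  by (rule partial_eqI[THEN trans]) auto

lemma smooth_map_ident: "smooth_map (\<lambda>x. x)"
proof (rule smooth_map_coinduct[where P="\<lambda>F. F = (\<lambda>x. x) \<or> (\<exists>c. F = (\<lambda>x. c))"])
  show "partial i F = (\<lambda>x. x) \<or> (\<exists>c. partial i F = (\<lambda>x. c))"
    if "F = (\<lambda>x. x) \<or> (\<exists>c. F = (\<lambda>x. c))" for F :: "real ^ 'n \<Rightarrow> real ^ 'n" and i
    using that by (elim disjE exE) (auto intro!: ext simp: partial_id)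
qed auto

text \<open>
  Up to a constant factor, each partial derivative of such an exponential is the exponential itself.
\<close>

lemma smooth_map_exp_linear:
  fixes L :: "real ^ 'n::finite \<Rightarrow> real"
  assumes "bounded_linear L"
  shows "smooth_map (\<lambda>x. exp (\<i> * complex_of_real (L x)))"
proof -
  have d: "((\<lambda>x. c * exp (\<i> * complex_of_real (L x))) has_derivative
      (\<lambda>h. c * (exp (\<i> * complex_of_real (L x)) * (\<i> * complex_of_real (L h))))) (at x)" for c x
  proof -
    have "((\<lambda>x. \<i> * complex_of_real (L x)) has_derivative (\<lambda>h. \<i> * complex_of_real (L h))) (at x)"
      using bounded_linear_imp_has_derivative[OF assms]
      by (intro has_derivative_mult_right has_derivative_of_real)
    moreover have "(exp has_derivative (\<lambda>h. exp (\<i> * complex_of_real (L x)) * h))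
        (at (\<i> * complex_of_real (L x)))"
      using DERIV_exp[of "\<i> * complex_of_real (L x)"] by (simp add: has_field_derivative_def)
    ultimately show ?thesis
      by (intro has_derivative_mult_right) (rule has_derivative_compose)
  qed
  show ?thesis
  proof (rule smooth_map_coinduct[where P="\<lambda>F. \<exists>c. F = (\<lambda>x. c * exp (\<i> * complex_of_real (L x)))"])
    show "\<exists>c. partial i F = (\<lambda>x. c * exp (\<i> * complex_of_real (L x)))"
      if F': "\<exists>c. F = (\<lambda>x. c * exp (\<i> * complex_of_real (L x)))" for F :: "real ^ 'n \<Rightarrow> complex" and i
    proof -
      obtain c where F: "F = (\<lambda>x. c * exp (\<i> * complex_of_real (L x)))" using F' by blast
      have "partial i F = (\<lambda>x. (c * (\<i> * complex_of_real (L (axis i 1)))) * exp (\<i> * complex_of_real (L x)))"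
        unfolding F by (rule ext) (simp add: partial_eqI[OF d])
      then show ?thesis by blast
    qed
  next
    show "\<exists>c. (\<lambda>x. exp (\<i> * complex_of_real (L x))) = (\<lambda>x. c * exp (\<i> * complex_of_real (L x)))"
      by (intro exI[of _ 1]) simp
  qed (use d in \<open>auto simp: differentiable_def\<close>)
qed

section \<open>Symmetry of partial derivatives\<close>

text \<open>
  The second difference is symmetric in \<open>i\<close> and \<open>j\<close>, whereas its limit names the two partial
  derivatives in a definite order; uniqueness of the limit then makes them commute.  The mean value
  theorem in direction \<open>i\<close> turns the second difference into a difference of values of
  \<open>partial i F\<close>, which differentiability of \<open>partial i F\<close> at \<open>x\<close> evaluates.
\<close>

lemma second_difference_quotient_tendsto:
  fixes F :: "real ^ 'n::finite \<Rightarrow> real"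
  assumes F: "smooth_map F"
  shows "((\<lambda>h. (F (x + h *\<^sub>R axis i 1 + h *\<^sub>R axis j 1) - F (x + h *\<^sub>R axis i 1)
      - F (x + h *\<^sub>R axis j 1) + F x) / h\<^sup>2) \<longlongrightarrow> partial j (partial i F) x) (at_right 0)"
proof (rule tendstoI)
  fix e :: real assume e: "e > 0"
  define D where "D h = (\<Sum>k\<in>UNIV. h $ k *\<^sub>R partial k (partial i F) x)" for h
  have "(partial i F has_derivative D) (at x)"
    unfolding D_def by (intro has_derivative_partial smooth_mapD F)
  \<comment> \<open>The estimate is used at distances up to \<open>2 * h\<close> and \<open>h\<close>; with \<open>e / 4\<close> the
    errors add up to less than \<open>e * h\<close>.\<close>
  then obtain d where d: "d > 0" and D: "linear D"
    and est: "\<And>y. norm (y - x) < d \<Longrightarrow> \<bar>partial i F y - partial i F x - D (y - x)\<bar> \<le> e/4 * norm (y - x)"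
    using e unfolding has_derivative_at_alt
    by (metis bounded_linear.linear real_norm_def divide_pos_pos zero_less_numeral)
  have Dj: "D (axis j 1) = partial j (partial i F) x"
    unfolding D_def by (subst sum.remove[of _ j]) (auto simp: axis_def if_distrib cong: if_cong)
  have "dist ((F (x + h *\<^sub>R axis i 1 + h *\<^sub>R axis j 1) - F (x + h *\<^sub>R axis i 1)
      - F (x + h *\<^sub>R axis j 1) + F x) / h\<^sup>2) (partial j (partial i F) x) < e"
    if h: "0 < h" "h < d / 2" for h
  proof -
    define \<phi> where "\<phi> s = F (x + s *\<^sub>R axis i 1 + h *\<^sub>R axis j 1) - F (x + s *\<^sub>R axis i 1)" for s
    have dF: "((\<lambda>s. F (z + s *\<^sub>R axis i 1)) has_real_derivative partial i F (z + s *\<^sub>R axis i 1)) (at s)"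
      for z s
    proof -
      have "((\<lambda>s. z + s *\<^sub>R axis i 1) has_derivative (\<lambda>t. t *\<^sub>R axis i 1)) (at s)"
        by (auto intro!: derivative_eq_intros)
      from has_derivative_compose[OF this
          has_derivative_partial[OF smooth_map_differentiable[OF F]]]
      have "((\<lambda>s. F (z + s *\<^sub>R axis i 1)) has_derivative
          (\<lambda>t. \<Sum>k\<in>UNIV. (t *\<^sub>R axis i 1) $ k *\<^sub>R partial k F (z + s *\<^sub>R axis i 1))) (at s)" .
      moreover have "(\<lambda>t. \<Sum>k\<in>UNIV. (t *\<^sub>R axis i 1) $ k *\<^sub>R partial k F (z + s *\<^sub>R axis i 1))
          = (*) (partial i F (z + s *\<^sub>R axis i 1))"
        by (rule ext, subst sum.remove[of _ i]) (auto simp: axis_def if_distrib cong: if_cong)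
      ultimately show ?thesis by (simp add: has_field_derivative_def)
    qed
    have d\<phi>: "(\<phi> has_real_derivative (partial i F (x + h *\<^sub>R axis j 1 + s *\<^sub>R axis i 1)
        - partial i F (x + s *\<^sub>R axis i 1))) (at s)" for s
      unfolding \<phi>_def using DERIV_diff[OF dF[of "x + h *\<^sub>R axis j 1" s] dF[of x s]]
      by (simp add: add_ac)
    obtain \<xi> where \<xi>: "0 < \<xi>" "\<xi> < h" "\<phi> h - \<phi> 0 = (h - 0) *
        (partial i F (x + h *\<^sub>R axis j 1 + \<xi> *\<^sub>R axis i 1) - partial i F (x + \<xi> *\<^sub>R axis i 1))"
      using MVT2[OF h(1) d\<phi>] by blast
    let ?y = "x + h *\<^sub>R axis j 1 + \<xi> *\<^sub>R axis i 1" and ?z = "x + \<xi> *\<^sub>R axis i 1"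
    have nz: "norm (?z - x) \<le> h" using \<xi> by (simp add: norm_axis_1)
    have "norm (h *\<^sub>R axis j (1::real) + \<xi> *\<^sub>R axis i (1::real)) \<le> h + \<xi>"
      by (rule order_trans[OF norm_triangle_ineq]) (use \<xi> h in \<open>simp add: norm_axis_1\<close>)
    then have ny: "norm (?y - x) \<le> 2 * h" using \<xi> by (simp add: algebra_simps)
    have "\<bar>partial i F ?y - partial i F x - D (?y - x)\<bar> \<le> e * h / 2"
      using order_trans[OF est[of ?y] mult_left_mono[OF ny, of "e / 4"]] ny h e by simp
    moreover have "\<bar>partial i F ?z - partial i F x - D (?z - x)\<bar> \<le> e * h / 4"
      using order_trans[OF est[of ?z] mult_left_mono[OF nz, of "e / 4"]] nz h e by simp
    moreover have "D (?y - x) - D (?z - x) = h * D (axis j 1)"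
      using linear_diff[OF D, of "?y - x" "?z - x"] linear_cmul[OF D, of h "axis j 1"]
      by (simp add: algebra_simps)
    moreover have "\<bar>y - z - w\<bar> < t"
      if "\<bar>y - c - u\<bar> \<le> t / 2" "\<bar>z - c - v\<bar> \<le> t / 4" "u - v = w" "0 < t" for y z c u v w t :: real
      using that by linarith
    ultimately have *: "\<bar>partial i F ?y - partial i F ?z - h * D (axis j 1)\<bar> < e * h"
      using mult_pos_pos[OF e h(1)] by blast
    have eq: "F (x + h *\<^sub>R axis i 1 + h *\<^sub>R axis j 1) - F (x + h *\<^sub>R axis i 1)
        - F (x + h *\<^sub>R axis j 1) + F x = h * (partial i F ?y - partial i F ?z)"
      using \<xi>(3) by (simp add: \<phi>_def)
    have eq2: "h * (partial i F ?y - partial i F ?z) / h\<^sup>2 - D (axis j 1)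
       = (partial i F ?y - partial i F ?z - h * D (axis j 1)) / h"
      using h by (simp add: field_simps power2_eq_square)
    then show ?thesis
      unfolding eq Dj[symmetric] dist_real_def eq2 using * h by (simp add: pos_divide_less_eq)
  qed
  then show "\<forall>\<^sub>F h in at_right 0. dist ((F (x + h *\<^sub>R axis i 1 + h *\<^sub>R axis j 1) - F (x + h *\<^sub>R axis i 1)
      - F (x + h *\<^sub>R axis j 1) + F x) / h\<^sup>2) (partial j (partial i F) x) < e"
    using d by (auto simp: eventually_at_right intro!: exI[of _ "d / 2"])
qed

lemma partial_commute:
  fixes F :: "real ^ 'n::finite \<Rightarrow> 'b::euclidean_space"
  assumes F: "smooth_map F"
  shows "partial i (partial j F) = partial j (partial i F)"
proof (rule ext, rule euclidean_eqI)
  fix x and b :: 'b assume "b \<in> Basis"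
  have L: "bounded_linear (\<lambda>y::'b. y \<bullet> b)" by (rule bounded_linear_inner_left)
  define G where "G = (\<lambda>x. F x \<bullet> b)"
  have G: "smooth_map G" unfolding G_def by (rule smooth_map_linear[OF L F])
  have "partial j (partial i G) x = partial i (partial j G) x"
    by (rule tendsto_unique[OF _ second_difference_quotient_tendsto[OF G, of x i j]])
      (use second_difference_quotient_tendsto[OF G, of x j i] in \<open>simp_all add: algebra_simps\<close>)
  then show "partial i (partial j F) x \<bullet> b = partial j (partial i F) x \<bullet> b"
    using partials_linear[OF L F, of "[i, j]"] partials_linear[OF L F, of "[j, i]"]
    by (simp add: G_def fun_eq_iff)
qed

text \<open>
  The only consequence of symmetry that Taylor expansion uses: an index may be inserted at any
  position instead of the front.
\<close>

lemma partials_move_front: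
  fixes F :: "real ^ 'n::finite \<Rightarrow> 'b::euclidean_space"
  assumes "smooth_map F"
  shows "partials (us @ i # vs) F = partials (i # us @ vs) F"
proof (induction us)
  case (Cons u us)
  then show ?case
    using partial_commute[OF smooth_map_partials[OF assms, of "us @ vs"], of u i] by simp
qed simp

section \<open>Smoothness of the Fourier modes\<close>

text \<open>
  Differentiation under the integral sign turns \<open>F\<close> into a linear combination of its partial
  derivatives, which is again smooth.  Integrals of this shape, with \<open>F\<close> an arbitrary smooth
  function, therefore form a class closed under partial derivatives.
\<close>

lemma smooth_map_parametric_integral:
  fixes F :: "real ^ 'n::finite \<Rightarrow> complex" and A :: "real ^ 'm::finite \<Rightarrow> real ^ 'n"
    and B :: "'e::euclidean_space \<Rightarrow> real ^ 'n"
  assumes A: "bounded_linear A" and B: "bounded_linear B"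
    and e: "continuous_on (cbox p q) e" and F: "smooth_map F"
  shows "smooth_map (\<lambda>x. integral (cbox p q) (\<lambda>t. e t * F (A x + B t)))"
proof (rule smooth_map_coinduct
    [where P="\<lambda>H. \<exists>F. smooth_map F \<and> H = (\<lambda>x. integral (cbox p q) (\<lambda>t. e t * F (A x + B t)))"])
  have *: "((\<lambda>x. integral (cbox p q) (\<lambda>t. e t * F (A x + B t))) has_derivative
     (\<lambda>h. integral (cbox p q) (\<lambda>t. e t * (\<Sum>j\<in>UNIV. A h $ j *\<^sub>R partial j F (A x + B t))))) (at x)"
    if F: "smooth_map F" for F :: "real ^ 'n \<Rightarrow> complex" and x
  proof -
    have cont: "continuous_on UNIV G" if "smooth_map G" for G :: "real ^ 'n \<Rightarrow> complex"
      using smooth_map_differentiable[OF that]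
      by (auto intro!: continuous_at_imp_continuous_on differentiable_imp_continuous_within)
    have cA: "continuous_on S A" and cB: "continuous_on T B" for S T
      using A B by (auto intro: linear_continuous_on)
    define fx where "fx x t = Blinfun (\<lambda>h. e t * (\<Sum>j\<in>UNIV. A h $ j *\<^sub>R partial j F (A x + B t)))"
      for x t
    have "bounded_linear (\<lambda>h. e t * (\<Sum>j\<in>UNIV. A h $ j *\<^sub>R partial j F (A x + B t)))" for x t
      by (intro bounded_linear_const_mult bounded_linear_sum bounded_linear_scaleR_const
          bounded_linear_compose[OF bounded_linear_vec_nth A])
    then have fx: "blinfun_apply (fx x t) =
        (\<lambda>h. e t * (\<Sum>j\<in>UNIV. A h $ j *\<^sub>R partial j F (A x + B t)))" for x t
      unfolding fx_def by (rule bounded_linear_Blinfun_apply)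
    have c: "continuous_on (UNIV \<times> cbox p q) (\<lambda>z. e (snd z) *
        (\<Sum>j\<in>UNIV. A i $ j *\<^sub>R partial j F (A (fst z) + B (snd z))))" for i
      by (intro continuous_intros continuous_on_compose2[OF e]
          continuous_on_compose2[OF cont[OF smooth_map_partial[OF F]]]
          continuous_on_compose2[OF cA[of UNIV]] continuous_on_compose2[OF cB[of UNIV]]) auto
    have c': "continuous_on (cbox p q) (\<lambda>t. e t *
        (\<Sum>j\<in>UNIV. A i $ j *\<^sub>R partial j F (A x + B t)))" for i
      by (intro continuous_intros e cB
          continuous_on_compose2[OF cont[OF smooth_map_partial[OF F]]]) auto
    have cfx: "continuous_on (UNIV \<times> cbox p q) (\<lambda>(x, t). fx x t)"
      by (rule continuous_on_blinfun_componentwise) (use c in \<open>simp add: split_beta fx\<close>)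
    have "((\<lambda>x. integral (cbox p q) (\<lambda>t. e t * F (A x + B t))) has_derivative
        integral (cbox p q) (fx x)) (at x)"
    proof (rule leibniz_rule)
      show "((\<lambda>x. e t * F (A x + B t)) has_derivative blinfun_apply (fx x t)) (at x)" for x t
      proof -
        have "((\<lambda>x. A x + B t) has_derivative A) (at x)"
          using bounded_linear_imp_has_derivative[OF A] by (auto intro!: derivative_eq_intros)
        from has_derivative_compose[OF this
            has_derivative_partial[OF smooth_map_differentiable[OF F]]]
        show ?thesis unfolding fx by (rule has_derivative_mult_right)
      qed
      show "(\<lambda>t. e t * F (A x + B t)) integrable_on cbox p q" for x
        by (intro integrable_continuous continuous_intros e cB continuous_on_compose2[OF cont[OF F]]) auto
    qed (use cfx in auto)
    moreover have "blinfun_apply (integral (cbox p q) (fx x)) =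
      (\<lambda>h. integral (cbox p q) (\<lambda>t. e t * (\<Sum>j\<in>UNIV. A h $ j *\<^sub>R partial j F (A x + B t))))"
    proof (rule ext)
      fix h
      have "continuous_on (cbox p q) (\<lambda>t. fx x t)"
        by (rule continuous_on_blinfun_componentwise) (use c' in \<open>simp add: fx\<close>)
      then show "blinfun_apply (integral (cbox p q) (fx x)) h = integral (cbox p q)
          (\<lambda>t. e t * (\<Sum>j\<in>UNIV. A h $ j *\<^sub>R partial j F (A x + B t)))"
        by (subst blinfun_apply_integral) (auto intro: integrable_continuous simp: fx)
    qed
    ultimately show ?thesis by simp
  qed
  show "H differentiable at x"
    if "\<exists>F. smooth_map F \<and> H = (\<lambda>x. integral (cbox p q) (\<lambda>t. e t * F (A x + B t)))" for H and x
    using that * by (auto simp: differentiable_def)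
  show "\<exists>F. smooth_map F \<and> partial i H = (\<lambda>x. integral (cbox p q) (\<lambda>t. e t * F (A x + B t)))"
    if "\<exists>F. smooth_map F \<and> H = (\<lambda>x. integral (cbox p q) (\<lambda>t. e t * F (A x + B t)))" for H i
  proof -
    obtain F where F: "smooth_map F" "H = (\<lambda>x. integral (cbox p q) (\<lambda>t. e t * F (A x + B t)))"
      using \<open>\<exists>F. _\<close> by blast
    define G where "G y = (\<Sum>j\<in>UNIV. A (axis i 1) $ j *\<^sub>R partial j F y)" for y
    have "smooth_map G"
      unfolding G_def
      by (intro smooth_map_sum smooth_map_linear[OF bounded_linear_scaleR_right] smooth_map_partial F) auto
    moreover have "partial i H = (\<lambda>x. integral (cbox p q) (\<lambda>t. e t * G (A x + B t)))"
      unfolding F(2) G_def by (rule ext, rule partial_eqI[OF *[OF F(1)]])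
    ultimately show ?thesis by blast
  qed
qed (use F in blast)

lemma with_angles_split: "with_angles \<iota> x \<theta> = with_angles \<iota> x 0 + with_angles \<iota> 0 \<theta>"
  by (auto simp: with_angles_def vec_eq_iff)

lemma bounded_linear_angle_maps:
  shows bounded_linear_with_angles_state: "bounded_linear (\<lambda>x. with_angles \<iota> x 0)"
    and bounded_linear_with_angles_angles: "bounded_linear (with_angles \<iota> 0)"
    and bounded_linear_idot: "bounded_linear (idot k)"
    and bounded_linear_angles: "bounded_linear (angles \<iota>)"
  unfolding linear_conv_bounded_linear[symmetric]
  by (rule linearI;
    simp add: with_angles_def idot_def angles_def vec_eq_iff sum.distrib sum_distrib_left algebra_simps)+

lemma continuous_on_smooth_map: "smooth_map F \<Longrightarrow> continuous_on S F"
  by (auto intro!: continuous_at_imp_continuous_on differentiable_imp_continuous_within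
      intro: smooth_map_differentiable)

text \<open>
  The Fourier coefficient is a parametric integral in which the angles are integrated out and the
  state moves only the remaining coordinates.
\<close>

lemma smooth_map_fourier_mode:
  assumes f: "smooth_map f"
  shows "smooth_map (\<lambda>x. fourier_mode \<iota> f k x $ i)"
proof -
  define e where "e = (\<lambda>\<theta>. exp (- \<i> * complex_of_real (idot k \<theta>)))"
  have ce: "continuous_on S e" for S
    unfolding e_def
    by (intro continuous_intros linear_continuous_on bounded_linear_idot)
  have cf: "continuous_on S (\<lambda>\<theta>. f (with_angles \<iota> x \<theta>))" for S x
    by (subst with_angles_split, intro continuous_on_compose2[OF continuous_on_smooth_map[OF f, of UNIV]]
        continuous_intros linear_continuous_on bounded_linear_angle_maps) auto
  have "fourier_coeff \<iota> f k x $ i = (1 / (2 * pi) ^ CARD('b)) *\<^sub>R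
      integral (cbox 0 (\<chi> j. 2 * pi)) (\<lambda>\<theta>. e \<theta> * complex_of_real (f (with_angles \<iota> x \<theta>) $ i))" for x
  proof -
    have "continuous_on S (\<lambda>\<theta>. e \<theta> *s cvec (f (with_angles \<iota> x \<theta>)))" for S
      unfolding vector_scalar_mult_def cvec_def
      by (intro continuous_intros ce cf)
    then have "(\<lambda>\<theta>. e \<theta> *s cvec (f (with_angles \<iota> x \<theta>))) integrable_on cbox 0 (\<chi> j. 2 * pi)"
      by (rule integrable_continuous)
    from integral_linear[OF this bounded_linear_vec_nth[of i]]
    show ?thesis by (simp add: fourier_coeff_def e_def cvec_def o_def)
  qed
  then have eq: "(\<lambda>x. fourier_mode \<iota> f k x $ i) =
     (\<lambda>x. exp (\<i> * complex_of_real (idot k (angles \<iota> x))) * ((1 / (2 * pi) ^ CARD('b)) *\<^sub>R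
      integral (cbox 0 (\<chi> j. 2 * pi))
        (\<lambda>\<theta>. e \<theta> * complex_of_real (f (with_angles \<iota> x 0 + with_angles \<iota> 0 \<theta>) $ i))))"
    by (subst with_angles_split[symmetric]) (simp add: fourier_mode_def)
  have "smooth_map (\<lambda>x. complex_of_real (f x $ i))"
    by (intro smooth_map_linear[OF bounded_linear_compose[OF bounded_linear_of_real bounded_linear_vec_nth]] f)
  then show ?thesis
    unfolding eq
    by (intro smooth_map_mult smooth_map_exp_linear smooth_map_linear[OF bounded_linear_scaleR_right]
        smooth_map_parametric_integral ce
        bounded_linear_compose[OF bounded_linear_idot bounded_linear_angles] bounded_linear_angle_maps)
qed

section \<open>Shuffles and their dual\<close>

lemma finite_words [simp]: "finite {w. mset w = m}"
proof (rule finite_subset)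
  show "{w. mset w = m} \<subseteq> {w. set w \<subseteq> set_mset m \<and> length w = size m}"
    by auto
qed (simp add: finite_lists_length_eq)

lemma shuffle_mset_Nil_right [simp]: "shuffle_mset u [] = {#u#}"
  by (cases u) auto

lemma length_shuffle: "w \<in># shuffle_mset u v \<Longrightarrow> length w = length u + length v"
  by (induction u v arbitrary: w rule: shuffle_mset.induct) auto

lemma mset_shuffle: "w \<in># shuffle_mset u v \<Longrightarrow> mset w = mset u + mset v"
  by (induction u v arbitrary: w rule: shuffle_mset.induct) auto

lemma size_shuffle_mset: "size (shuffle_mset u v) = (length u + length v) choose length u"
  by (induction u v rule: shuffle_mset.induct) auto

text \<open>
  The coproduct dual to the shuffle product: all ways to distribute the letters of a word over two
  subwords.  Recursion on the word makes it the natural way to iterate Leibniz' rule.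
\<close>

primrec deshuffle :: "'a list \<Rightarrow> ('a list \<times> 'a list) multiset" where
  "deshuffle [] = {#([], [])#}"
| "deshuffle (k # w) =
     image_mset (map_prod ((#) k) id) (deshuffle w) + image_mset (map_prod id ((#) k)) (deshuffle w)"

lemma mset_deshuffle: "(u, v) \<in># deshuffle w \<Longrightarrow> mset u + mset v = mset w"
  by (induction w arbitrary: u v) auto

lemma count_image_mset_inj: "inj f \<Longrightarrow> count (image_mset f M) (f x) = count M x"
  by (induction M) (auto dest: injD)

lemma count_image_Cons:
  "count (image_mset ((#) k) M) w = (case w of [] \<Rightarrow> 0 | l # w' \<Rightarrow> if l = k then count M w' else 0)"
proof (cases w)
  case (Cons l w')
  show ?thesis
  proof (cases "l = k")
    case True
    then show ?thesis using count_image_mset_inj[of "(#) k" M w'] Cons by auto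
  qed (use Cons in \<open>auto simp: not_in_iff[symmetric]\<close>)
qed (auto simp: not_in_iff[symmetric])

lemma count_image_Cons_fst:
  "count (image_mset (map_prod ((#) k) id) M) (u, v) =
    (case u of [] \<Rightarrow> 0 | l # u' \<Rightarrow> if l = k then count M (u', v) else 0)"
proof (cases u)
  case (Cons l u')
  have "inj (map_prod ((#) k) id)" by (auto simp: inj_on_def)
  from count_image_mset_inj[OF this, of M "(u', v)"] show ?thesis
    by (cases "l = k") (use Cons in \<open>auto simp: not_in_iff[symmetric]\<close>)
qed (auto simp: not_in_iff[symmetric])

lemma count_image_Cons_snd:
  "count (image_mset (map_prod id ((#) k)) M) (u, v) =
    (case v of [] \<Rightarrow> 0 | l # v' \<Rightarrow> if l = k then count M (u, v') else 0)"
proof (cases v)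
  case (Cons l v')
  have "inj (map_prod id ((#) k))" by (auto simp: inj_on_def)
  from count_image_mset_inj[OF this, of M "(u, v')"] show ?thesis
    by (cases "l = k") (use Cons in \<open>auto simp: not_in_iff[symmetric]\<close>)
qed (auto simp: not_in_iff[symmetric])

lemma count_deshuffle: "count (deshuffle w) (u, v) = count (shuffle_mset u v) w"
proof (induction w arbitrary: u v)
  case Nil
  then show ?case by (cases u; cases v) (auto simp: not_in_iff[symmetric])
next
  case (Cons k w)
  show ?case
    by (cases u; cases v)
      (auto simp: count_image_Cons count_image_Cons_fst count_image_Cons_snd Cons.IH)
qed

lemma sum_mset_eq_sum_count:
  fixes G :: "'a \<Rightarrow> 'b::comm_semiring_1"
  assumes "finite S" "set_mset M \<subseteq> S"
  shows "(\<Sum>x\<in>#M. G x) = (\<Sum>x\<in>S. of_nat (count M x) * G x)"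
proof -
  have "(\<Sum>x\<in>S. of_nat (count M x) * G x) = (\<Sum>x\<in>set_mset M. of_nat (count M x) * G x)"
    by (rule sum.mono_neutral_right) (use assms in \<open>auto simp: not_in_iff\<close>)
  also have "\<dots> = (\<Sum>x\<in>#M. G x)"
  proof (induction M)
    case (add y M)
    have "(\<Sum>x\<in>set_mset (add_mset y M). of_nat (count (add_mset y M) x) * G x)
       = (\<Sum>x\<in>insert y (set_mset M). of_nat (count M x) * G x + (if x = y then G x else 0))"
      by (intro sum.cong) (auto simp: algebra_simps)
    also have "\<dots> = (\<Sum>x\<in>insert y (set_mset M). of_nat (count M x) * G x) + G y"
      by (subst sum.distrib) simp
    also have "(\<Sum>x\<in>insert y (set_mset M). of_nat (count M x) * G x)
       = (\<Sum>x\<in>set_mset M. of_nat (count M x) * G x)"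
      by (rule sum.mono_neutral_right) (auto simp: not_in_iff)
    finally show ?case using add by (simp add: add_ac)
  qed simp
  finally show ?thesis by simp
qed

lemma finite_word_pairs: "finite {(u, v). mset u + mset v = m}"
proof (rule finite_subset)
  show "{(u, v). mset u + mset v = m} \<subseteq>
      (\<lambda>(w, i). (take i w, drop i w)) ` ({w. mset w = m} \<times> {..size m})"
  proof clarify
    fix u v assume "m = mset u + mset v"
    then show "(u, v) \<in> (\<lambda>(w, i). (take i w, drop i w)) `
        ({w. mset w = mset u + mset v} \<times> {..size (mset u + mset v)})"
      by (intro image_eqI[of _ _ "(u @ v, length u)"]) auto
  qed
qed simp

text \<open>
  Summed form of the duality \<open>count_deshuffle\<close>.  It moves a sum over words, as Leibniz' rule
  produces it, to a sum over pairs of words, where the shuffle relations apply.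
\<close>

lemma sum_deshuffle_eq_sum_shuffle:
  fixes G :: "'a list \<Rightarrow> 'a list \<Rightarrow> 'a list \<Rightarrow> 'b::comm_semiring_1"
  shows "(\<Sum>w | mset w = m. \<Sum>(u, v)\<in>#deshuffle w. G w u v) =
    (\<Sum>(u, v) | mset u + mset v = m. \<Sum>w\<in>#shuffle_mset u v. G w u v)"
proof -
  have "(\<Sum>w | mset w = m. \<Sum>(u, v)\<in>#deshuffle w. G w u v) =
     (\<Sum>w | mset w = m. \<Sum>(u, v) | mset u + mset v = m. of_nat (count (deshuffle w) (u, v)) * G w u v)"
  proof (rule sum.cong[OF refl])
    fix w assume "w \<in> {w. mset w = m}"
    then show "(\<Sum>(u, v)\<in>#deshuffle w. G w u v) =
        (\<Sum>(u, v) | mset u + mset v = m. of_nat (count (deshuffle w) (u, v)) * G w u v)"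
      by (subst sum_mset_eq_sum_count[OF finite_word_pairs])
        (auto dest: mset_deshuffle simp: split_def)
  qed
  also have "\<dots> = (\<Sum>(u, v) | mset u + mset v = m. \<Sum>w | mset w = m.
      of_nat (count (shuffle_mset u v) w) * G w u v)"
    by (subst sum.swap) (simp add: split_def count_deshuffle)
  also have "\<dots> = (\<Sum>(u, v) | mset u + mset v = m. \<Sum>w\<in>#shuffle_mset u v. G w u v)"
  proof (rule sum.cong[OF refl], clarify)
    fix u v assume "m = mset u + mset v"
    then show "(\<Sum>w | mset w = mset u + mset v. of_nat (count (shuffle_mset u v) w) * G w u v) =
        (\<Sum>w\<in>#shuffle_mset u v. G w u v)"
      by (subst sum_mset_eq_sum_count[OF finite_words[of "mset u + mset v"]]) (auto dest: mset_shuffle)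
  qed
  finally show ?thesis .
qed

section \<open>The group of shuffle characters\<close>

definition word_conv :: "('a list \<Rightarrow> complex) \<Rightarrow> ('a list \<Rightarrow> complex) \<Rightarrow> 'a list \<Rightarrow> complex"
    (infixl "\<star>" 70) where
  "(\<gamma> \<star> \<delta>) w = (\<Sum>i\<le>length w. \<gamma> (take i w) * \<delta> (drop i w))"

abbreviation shuffle_sum :: "'a list \<Rightarrow> 'a list \<Rightarrow> ('a list \<Rightarrow> complex) \<Rightarrow> complex" where
  "shuffle_sum u v G \<equiv> (\<Sum>w\<in>#shuffle_mset u v. G w)"

lemma shuffle_sum_Cons:
  "shuffle_sum (x # u) (y # v) G =
    shuffle_sum u (y # v) (\<lambda>w. G (x # w)) + shuffle_sum (x # u) v (\<lambda>w. G (y # w))"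
  by (simp add: image_mset.compositionality o_def)

lemma deconcatenate_Cons:
  fixes G :: "'a list \<Rightarrow> 'a list \<Rightarrow> complex"
  shows "(\<Sum>i\<le>length (x # w). G (take i (x # w)) (drop i (x # w))) =
    G [] (x # w) + (\<Sum>i\<le>length w. G (x # take i w) (drop i w))"
  by (simp add: sum.atMost_Suc_shift del: sum.atMost_Suc)

text \<open>
  Deconcatenation is compatible with shuffling (the bialgebra property): a cut of a shuffle of \<open>u\<close>
  and \<open>v\<close> arises from a cut of \<open>u\<close> and a cut of \<open>v\<close> by shuffling the two front parts and the two
  rear parts.  This is why \<open>word_group\<close> is closed under convolution.
\<close>

lemma shuffle_deconcatenate:
  "shuffle_sum u v (\<lambda>w. \<Sum>i\<le>length w. G (take i w) (drop i w)) =
    (\<Sum>i\<le>length u. \<Sum>j\<le>length v. shuffle_sum (take i u) (take j v)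
       (\<lambda>w'. shuffle_sum (drop i u) (drop j v) (\<lambda>w''. G w' w'')))"
proof (induction u v arbitrary: G rule: shuffle_mset.induct)
  case (3 x u y v)
  let ?S = "\<lambda>G i j u v. shuffle_sum (take i u) (take j v) (\<lambda>w'. shuffle_sum (drop i u) (drop j v) (\<lambda>w''. G w' w''))"
  let ?Gx = "\<lambda>w. G (x # w)" and ?Gy = "\<lambda>w. G (y # w)"
  have "shuffle_sum (x # u) (y # v) (\<lambda>w. \<Sum>i\<le>length w. G (take i w) (drop i w)) =
     shuffle_sum (x # u) (y # v) (G [])
     + shuffle_sum u (y # v) (\<lambda>w. \<Sum>i\<le>length w. ?Gx (take i w) (drop i w))
     + shuffle_sum (x # u) v (\<lambda>w. \<Sum>i\<le>length w. ?Gy (take i w) (drop i w))"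
    unfolding shuffle_sum_Cons deconcatenate_Cons by (simp add: sum_mset.distrib add_ac)
  also have "\<dots> = shuffle_sum (x # u) (y # v) (G [])
     + (\<Sum>i\<le>length u. \<Sum>j\<le>length (y # v). ?S ?Gx i j u (y # v))
     + (\<Sum>i\<le>length (x # u). \<Sum>j\<le>length v. ?S ?Gy i j (x # u) v)"
    by (simp only: "3.IH"(1)[of ?Gx] "3.IH"(2)[of ?Gy])
  also have "\<dots> = (\<Sum>i\<le>length (x # u). \<Sum>j\<le>length (y # v). ?S G i j (x # u) (y # v))"
    by (simp add: sum.atMost_Suc_shift sum.distrib shuffle_sum_Cons add_ac 
      del: sum.atMost_Suc shuffle_mset.simps(3))
  finally show ?case .
qed auto

lemma word_groupI:
  "\<gamma> [] = 1 \<Longrightarrow> (\<And>u v. shuffle_sum u v \<gamma> = \<gamma> u * \<gamma> v) \<Longrightarrow> \<gamma> \<in> word_group"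
  by (simp add: word_group_def)

lemma word_conv_group:
  assumes "\<gamma> \<in> word_group" "\<delta> \<in> word_group"
  shows "\<gamma> \<star> \<delta> \<in> word_group"
proof -
  have sh: "shuffle_sum u v \<gamma> = \<gamma> u * \<gamma> v" "shuffle_sum u v \<delta> = \<delta> u * \<delta> v" for u v
    using assms by (auto simp: word_group_def)
  have "shuffle_sum u v (\<gamma> \<star> \<delta>) = (\<gamma> \<star> \<delta>) u * (\<gamma> \<star> \<delta>) v" for u v
  proof -
    have "shuffle_sum u v (\<gamma> \<star> \<delta>) =
      (\<Sum>i\<le>length u. \<Sum>j\<le>length v. shuffle_sum (take i u) (take j v)
       (\<lambda>w'. shuffle_sum (drop i u) (drop j v) (\<lambda>w''. \<gamma> w' * \<delta> w'')))"
      unfolding word_conv_def by (rule shuffle_deconcatenate)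
    also have "\<dots> = (\<Sum>i\<le>length u. \<Sum>j\<le>length v.
        (\<gamma> (take i u) * \<delta> (drop i u)) * (\<gamma> (take j v) * \<delta> (drop j v)))"
      by (simp add: sum_mset_distrib_left[symmetric] sum_mset_distrib_right[symmetric] sh mult_ac)
    finally show ?thesis by (simp add: word_conv_def sum_product)
  qed
  then show ?thesis
    by (rule word_groupI[rotated]) (use assms in \<open>simp add: word_group_def word_conv_def\<close>)
qed

definition word_unit :: "'a list \<Rightarrow> complex" where
  "word_unit w = (if w = [] then 1 else 0)"

definition word_exp :: "real \<Rightarrow> 'a list \<Rightarrow> complex" where
  "word_exp t w = complex_of_real (t ^ length w / fact (length w))"

definition word_twist :: "real ^ 'd::finite \<Rightarrow> ('d word \<Rightarrow> complex) \<Rightarrow> 'd word \<Rightarrow> complex" where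
  "word_twist u \<delta> w = exp (\<i> * complex_of_real (\<Sum>k\<leftarrow>w. idot k u)) * \<delta> w"

text \<open>
  A shuffle of words of lengths \<open>m\<close> and \<open>n\<close> has \<open>(m + n choose m)\<close> terms, all of length \<open>m + n\<close>.
\<close>

lemma word_exp_group: "word_exp t \<in> word_group"
proof -
  have "shuffle_sum u v (word_exp t) = word_exp t u * word_exp t v" for u v :: "'a list"
  proof -
    let ?m = "length u" and ?n = "length v"
    have "shuffle_sum u v (word_exp t) =
        (\<Sum>w\<in>#shuffle_mset u v. complex_of_real (t ^ (?m + ?n) / fact (?m + ?n)))"
      by (intro arg_cong[where f=sum_mset] image_mset_cong) (auto simp: word_exp_def dest: length_shuffle)
    also have "\<dots> = complex_of_real (real ((?m + ?n) choose ?m) * (t ^ (?m + ?n) / fact (?m + ?n)))"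
      by (simp add: size_shuffle_mset sum_mset_constant)
    also have "real ((?m + ?n) choose ?m) = fact (?m + ?n) / (fact ?m * fact ?n)"
      by (subst binomial_fact) auto
    finally show ?thesis by (simp add: word_exp_def power_add)
  qed
  then show ?thesis by (rule word_groupI[rotated]) (simp add: word_exp_def)
qed

lemma word_unit_group: "word_unit \<in> word_group"
proof -
  have "shuffle_sum u v word_unit = word_unit u * word_unit v" for u v :: "'a list"
    by (induction u v rule: shuffle_mset.induct) 
      (auto simp: word_unit_def image_mset.compositionality o_def)
  then show ?thesis by (rule word_groupI[rotated]) (simp add: word_unit_def)
qed

lemma word_twist_group:
  assumes "\<delta> \<in> word_group"
  shows "word_twist u \<delta> \<in> word_group"
proof -
  have "shuffle_sum v w (word_twist u \<delta>) = word_twist u \<delta> v * word_twist u \<delta> w" for v w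
  proof -
    let ?s = "\<lambda>w. \<Sum>k\<leftarrow>w. idot k u"
    have s: "?s z = ?s v + ?s w" if "z \<in># shuffle_mset v w" for z
      using mset_shuffle[OF that] by (metis mset_append mset_map sum_list_append sum_mset_sum_list map_append)
    have "shuffle_sum v w (word_twist u \<delta>) =
        shuffle_sum v w (\<lambda>z. exp (\<i> * complex_of_real (?s v + ?s w)) * \<delta> z)"
      by (intro arg_cong[where f=sum_mset] image_mset_cong) (simp add: word_twist_def s)
    also have "\<dots> = exp (\<i> * complex_of_real (?s v + ?s w)) * (\<delta> v * \<delta> w)"
      using assms by (simp add: sum_mset_distrib_left[symmetric] word_group_def)
    finally show ?thesis by (simp add: word_twist_def exp_add distrib_left)
  qed
  then show ?thesis
    by (rule word_groupI[rotated]) (use assms in \<open>simp add: word_group_def word_twist_def\<close>)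
qed

lemma word_conv_unit: "\<gamma> \<star> word_unit = \<gamma>"
proof
  fix w
  have "(\<gamma> \<star> word_unit) w = (\<Sum>i\<le>length w. if i = length w then \<gamma> w else 0)"
    unfolding word_conv_def by (rule sum.cong) (auto simp: word_unit_def)
  then show "(\<gamma> \<star> word_unit) w = \<gamma> w" by simp
qed

lemma word_twist_unit: "word_twist u word_unit = word_unit"
  by (auto simp: word_twist_def word_unit_def)

section \<open>Words as differential operators\<close>

lemma smooth_map_sum_mset:
  "(\<And>a. a \<in># M \<Longrightarrow> smooth_map (F a)) \<Longrightarrow> smooth_map (\<lambda>x. \<Sum>a\<in>#M. F a x)"
  by (induction M) (auto intro: smooth_map_const smooth_map_add)

lemma sum_mset_sum_swap:
  "finite A \<Longrightarrow> (\<Sum>a\<in>#M. \<Sum>j\<in>A. f a j) = (\<Sum>j\<in>A. \<Sum>a\<in>#M. f a j)"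
  by (induction M) (auto simp: sum.distrib)

lemma smooth_map_coordinate: "smooth_map (\<lambda>x. complex_of_real (x $ i))"
  by (intro smooth_map_linear[OF bounded_linear_compose[OF bounded_linear_of_real bounded_linear_vec_nth]]
      smooth_map_ident)

lemma partial_coordinate: "partial j (\<lambda>x. complex_of_real (x $ i)) x = (if j = i then 1 else 0)"
proof -
  have "partial j (\<lambda>x. complex_of_real (x $ i)) x = complex_of_real (partial j (\<lambda>x. x) x $ i)"
    by (rule partial_linear[OF bounded_linear_compose[OF bounded_linear_of_real bounded_linear_vec_nth]]) auto
  then show ?thesis by (simp add: partial_id axis_def)
qed

lemma partial_shift:
  assumes "F differentiable at (x + U)"
  shows "partial i (\<lambda>x. F (x + U)) x = partial i F (x + U)"
proof -
  have "((\<lambda>x. x + U) has_derivative (\<lambda>h. h)) (at x)" by (auto intro!: derivative_eq_intros)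
  from has_derivative_compose[OF this assms[THEN frechet_derivative_works[THEN iffD1]]]
  show ?thesis by (rule partial_eqI[THEN trans]) (simp add: partial_def)
qed

lemma partials_shift:
  assumes "smooth_map F"
  shows "partials us (\<lambda>x. F (x + U)) = (\<lambda>x. partials us F (x + U))"
  by (induction us) (auto intro!: ext partial_shift smooth_mapD assms)

lemma smooth_map_shift:
  assumes "smooth_map F"
  shows "smooth_map (\<lambda>x. F (x + U))"
  unfolding smooth_map_def partials_shift[OF assms]
proof (intro allI)
  fix us x
  have "partials us F differentiable at (x + U)"
    by (intro smooth_mapD assms)
  from differentiable_compose[of "partials us F" "\<lambda>x. x + U", OF this]
  show "(\<lambda>x. partials us F (x + U)) differentiable at x" by simp
qed

locale smooth_fields =
  fixes g :: "'a \<Rightarrow> real ^ 'n::finite \<Rightarrow> complex ^ 'n"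
  assumes smooth_g: "smooth_map (\<lambda>x. g k x $ i)"
begin

definition lie :: "'a \<Rightarrow> (real ^ 'n \<Rightarrow> complex) \<Rightarrow> real ^ 'n \<Rightarrow> complex" where
  "lie k F x = (\<Sum>i\<in>UNIV. g k x $ i * partial i F x)"

primrec word_op :: "'a list \<Rightarrow> (real ^ 'n \<Rightarrow> complex) \<Rightarrow> real ^ 'n \<Rightarrow> complex" where
  "word_op [] F = F"
| "word_op (k # w) F = lie k (word_op w F)"

lemma word_op_append: "word_op (u @ v) F = word_op u (word_op v F)"
  by (induction u) auto

lemma smooth_map_lie: "smooth_map F \<Longrightarrow> smooth_map (lie k F)"
  unfolding lie_def by (intro smooth_map_sum smooth_map_mult smooth_g smooth_map_partial) auto

lemma smooth_map_word_op: "smooth_map F \<Longrightarrow> smooth_map (word_op w F)"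
  by (induction w) (auto intro: smooth_map_lie)

lemma lie_const [simp]: "lie k (\<lambda>x. c) = (\<lambda>x. 0)"
  by (auto simp: lie_def)

lemma lie_add:
  "smooth_map F \<Longrightarrow> smooth_map G \<Longrightarrow> lie k (\<lambda>x. F x + G x) = (\<lambda>x. lie k F x + lie k G x)"
  by (auto simp: lie_def partial_add smooth_map_differentiable sum.distrib algebra_simps)

lemma lie_mult:
  "smooth_map F \<Longrightarrow> smooth_map G \<Longrightarrow>
    lie k (\<lambda>x. F x * G x) = (\<lambda>x. lie k F x * G x + F x * lie k G x)"
  by (auto simp: lie_def partial_mult smooth_map_differentiable sum.distrib sum_distrib_left
      sum_distrib_right algebra_simps)

lemma lie_cmult: "smooth_map F \<Longrightarrow> lie k (\<lambda>x. c * F x) = (\<lambda>x. c * lie k F x)"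
  using lie_mult[of "\<lambda>x. c" F k] by (simp add: smooth_map_const)

lemma lie_sum:
  "finite A \<Longrightarrow> (\<And>a. a \<in> A \<Longrightarrow> smooth_map (F a)) \<Longrightarrow>
    lie k (\<lambda>x. \<Sum>a\<in>A. F a x) = (\<lambda>x. \<Sum>a\<in>A. lie k (F a) x)"
  by (induction A rule: finite_induct) (auto simp: lie_add smooth_map_sum)

lemma lie_sum_mset:
  "(\<And>a. a \<in># M \<Longrightarrow> smooth_map (F a)) \<Longrightarrow>
    lie k (\<lambda>x. \<Sum>a\<in>#M. F a x) = (\<lambda>x. \<Sum>a\<in>#M. lie k (F a) x)"
  by (induction M) (auto simp: lie_add smooth_map_sum_mset)

lemma word_op_const: "word_op w (\<lambda>x. c) = (\<lambda>x. if w = [] then c else 0)"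
  by (induction w) auto

lemma word_op_add:
  "smooth_map F \<Longrightarrow> smooth_map G \<Longrightarrow> word_op w (\<lambda>x. F x + G x) = (\<lambda>x. word_op w F x + word_op w G x)"
  by (induction w) (auto simp: lie_add smooth_map_word_op)

lemma word_op_cmult: "smooth_map F \<Longrightarrow> word_op w (\<lambda>x. c * F x) = (\<lambda>x. c * word_op w F x)"
  by (induction w) (auto simp: lie_cmult smooth_map_word_op)

lemma word_op_sum:
  "finite A \<Longrightarrow> (\<And>a. a \<in> A \<Longrightarrow> smooth_map (F a)) \<Longrightarrow>
    word_op w (\<lambda>x. \<Sum>a\<in>A. F a x) = (\<lambda>x. \<Sum>a\<in>A. word_op w (F a) x)"
  by (induction A rule: finite_induct) (auto simp: word_op_add word_op_const smooth_map_sum)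

abbreviation word_coord :: "'a list \<Rightarrow> 'n \<Rightarrow> real ^ 'n \<Rightarrow> complex" where
  "word_coord w i \<equiv> word_op w (\<lambda>x. complex_of_real (x $ i))"

text \<open>
  The coefficient of \<open>w\<close> in the displacement of the \<open>i\<close>-th coordinate; the identity part, carried by
  the empty word, is taken away.
\<close>

definition increment :: "'a list \<Rightarrow> 'n \<Rightarrow> real ^ 'n \<Rightarrow> complex" where
  "increment w i = (if w = [] then (\<lambda>x. 0) else word_coord w i)"

lemma smooth_map_increment: "smooth_map (increment w i)"
  by (auto simp: increment_def intro: smooth_map_const smooth_map_word_op smooth_map_coordinate)

lemma increment_Cons:
  "increment (k # w) i x = lie k (increment w i) x + (if w = [] then g k x $ i else 0)"
proof (cases "w = []")
  case True
  have "lie k (\<lambda>x. complex_of_real (x $ i)) x = g k x $ i"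
    unfolding lie_def by (simp add: partial_coordinate if_distrib[of "(*) _"] cong: if_cong)
  with True show ?thesis by (simp add: increment_def)
qed (simp add: increment_def)

text \<open>
  \<open>block_sum js w\<close> is what the word \<open>w\<close> makes of the product of the factors \<open>z $ j - x $ j\<close>,
  \<open>j\<close> in \<open>js\<close>, evaluated at \<open>z = x\<close>: by Leibniz' rule the letters of \<open>w\<close> are distributed over the
  factors, and a factor that receives no letter vanishes.
\<close>

primrec block_sum :: "'n list \<Rightarrow> 'a list \<Rightarrow> real ^ 'n \<Rightarrow> complex" where
  "block_sum [] w = (\<lambda>x. if w = [] then 1 else 0)"
| "block_sum (i # js) w = (\<lambda>x. \<Sum>(u, v)\<in>#deshuffle w. increment u i x * block_sum js v x)"

lemma smooth_map_block_sum: "smooth_map (block_sum js w)"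
  by (induction js arbitrary: w)
    (auto simp: split_def intro!: smooth_map_const smooth_map_sum_mset smooth_map_mult smooth_map_increment)

lemma sum_deshuffle_Nil:
  fixes G :: "'b list \<Rightarrow> complex"
  shows "(\<Sum>(u, v)\<in>#deshuffle w. if u = [] then G v else 0) = G w"
proof (induction w arbitrary: G)
  case (Cons k w)
  have "(\<lambda>(u :: 'b list, v). if u = [] then G v else 0) \<circ> map_prod id ((#) k) =
      (\<lambda>(u, v). if u = [] then G (k # v) else 0)"
    and "(\<lambda>(u :: 'b list, v). if u = [] then G v else 0) \<circ> map_prod ((#) k) id = (\<lambda>_. 0)"
    by auto
  then show ?case
    using Cons[of "\<lambda>v. G (k # v)"] by (simp add: image_mset.compositionality)
qed simp

lemma block_sum_eq_0: "length w < length js \<Longrightarrow> block_sum js w x = 0"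
proof (induction js arbitrary: w)
  case (Cons i js)
  have "increment u i x * block_sum js v x = 0" if "(u, v) \<in># deshuffle w" for u v
  proof (cases "u = []")
    case False
    have "length u + length v = length w"
      using mset_deshuffle[OF that] by (metis size_mset size_union)
    with False Cons.prems have "length v < length js" by (cases u) auto
    then show ?thesis by (simp add: Cons.IH)
  qed (simp add: increment_def)
  then have "(\<Sum>(u, v)\<in>#deshuffle w. increment u i x * block_sum js v x) = (\<Sum>(u, v)\<in>#deshuffle w. 0)"
    by (intro arg_cong[where f=sum_mset] image_mset_cong) auto
  then show ?case by (simp add: split_def)
qed simp

text \<open>
  A further letter \<open>k\<close> in front either is prepended to one of the existing blocks, which amounts to
  differentiating the whole product along \<open>k\<close>, or it forms a block of its own.
\<close>

lemma block_sum_Cons_word: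
  "block_sum js (k # w) x = lie k (block_sum js w) x +
    (\<Sum>j<length js. g k x $ (js ! j) * block_sum (take j js @ drop (Suc j) js) w x)"
proof (induction js arbitrary: w)
  case (Cons i js)
  have "block_sum (i # js) (k # w) x =
      (\<Sum>(u, v)\<in>#deshuffle w. increment (k # u) i x * block_sum js v x) +
      (\<Sum>(u, v)\<in>#deshuffle w. increment u i x * block_sum js (k # v) x)"
    by (simp add: image_mset.compositionality o_def split_def)
  \<comment> \<open>The three sums: \<open>k\<close> differentiates the product, \<open>k\<close> is the whole first block, \<open>k\<close> is a whole later block.\<close>
  also have "\<dots> = (\<Sum>(u, v)\<in>#deshuffle w. lie k (increment u i) x * block_sum js v x
         + increment u i x * lie k (block_sum js v) x)
      + (\<Sum>(u, v)\<in>#deshuffle w. if u = [] then g k x $ i * block_sum js v x else 0)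
      + (\<Sum>(u, v)\<in>#deshuffle w. \<Sum>j<length js.
          g k x $ (js ! j) * (increment u i x * block_sum (take j js @ drop (Suc j) js) v x))"
    unfolding sum_mset.distrib[symmetric]
    by (intro arg_cong[where f=sum_mset] image_mset_cong)
      (auto simp: increment_Cons Cons.IH algebra_simps sum_distrib_left)
  also have "(\<Sum>(u, v)\<in>#deshuffle w. lie k (increment u i) x * block_sum js v x
         + increment u i x * lie k (block_sum js v) x) = lie k (block_sum (i # js) w) x"
    unfolding block_sum.simps
    by (subst lie_sum_mset)
      (auto simp: split_def lie_mult smooth_map_increment smooth_map_block_sum smooth_map_mult)
  also have "(\<Sum>(u, v)\<in>#deshuffle w. if u = [] then g k x $ i * block_sum js v x else 0)
      = g k x $ i * block_sum js w x"
    by (rule sum_deshuffle_Nil)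
  also have "(\<Sum>(u, v)\<in>#deshuffle w. \<Sum>j<length js.
          g k x $ (js ! j) * (increment u i x * block_sum (take j js @ drop (Suc j) js) v x))
      = (\<Sum>j<length js. g k x $ (js ! j) * block_sum (i # take j js @ drop (Suc j) js) w x)"
    by (simp add: split_def sum_mset_sum_swap sum_mset_distrib_left)
  finally show ?case
    by (simp add: sum.lessThan_Suc_shift add_ac del: sum.lessThan_Suc)
qed simp

lemma finite_index_lists [simp]: "finite {js :: 'n list. length js = l}"
  using finite_lists_length_eq[of "UNIV :: 'n set" l] by simp

text \<open>
  Every list of length \<open>l + 1\<close> arises from \<open>l + 1\<close> pairs of an index and a list of length \<open>l\<close>,
  according to the position that is singled out; symmetry of the partial derivatives makes all
  positions contribute equally.  The factor \<open>l + 1\<close> is what turns \<open>1 / (l + 1)!\<close> into \<open>1 / l!\<close>.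
\<close>

lemma sum_remove_index:
  fixes A :: "'n \<Rightarrow> 'n list \<Rightarrow> complex"
  assumes F: "smooth_map F"
  shows "(\<Sum>js | length js = Suc l. \<Sum>j<Suc l. A (js ! j) (take j js @ drop (Suc j) js) * partials js F x)
    = of_nat (Suc l) * (\<Sum>js | length js = l. \<Sum>i\<in>UNIV. A i js * partials (i # js) F x)"
proof -
  have "(\<Sum>js | length js = Suc l. A (js ! j) (take j js @ drop (Suc j) js) * partials js F x)
     = (\<Sum>(js, i)\<in>{js. length js = l} \<times> UNIV. A i js * partials (i # js) F x)" if "j < Suc l" for j
  proof (rule sum.reindex_bij_witness[where j="\<lambda>js. (take j js @ drop (Suc j) js, js ! j)"
        and i="\<lambda>(js, i). take j js @ i # drop j js"])
    fix js :: "'n list" assume js: "js \<in> {js. length js = Suc l}"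
    have *: "take j js @ js ! j # drop (Suc j) js = js"
      using js that by (simp add: id_take_nth_drop[symmetric])
    then show "(case (take j js @ drop (Suc j) js, js ! j) of (js, i) \<Rightarrow> take j js @ i # drop j js) = js"
      using js that by (simp add: min_def)
    have "partials js F x = partials (take j js @ js ! j # drop (Suc j) js) F x"
      by (simp only: *)
    also have "\<dots> = partials (js ! j # take j js @ drop (Suc j) js) F x"
      by (simp only: partials_move_front[OF F])
    finally show "(case (take j js @ drop (Suc j) js, js ! j) of
        (js, i) \<Rightarrow> A i js * partials (i # js) F x) =
        A (js ! j) (take j js @ drop (Suc j) js) * partials js F x" by simp
  qed (use that in \<open>auto simp: min_def nth_append\<close>)
  then have "(\<Sum>j<Suc l. \<Sum>js | length js = Suc l. A (js ! j) (take j js @ drop (Suc j) js) * partials js F x)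
    = of_nat (Suc l) * (\<Sum>(js, i)\<in>{js. length js = l} \<times> UNIV. A i js * partials (i # js) F x)"
    by simp
  then show ?thesis by (subst sum.swap) (simp add: sum.cartesian_product)
qed

text \<open>
  Formula of Faa di Bruno for the operator of a word: the Taylor expansion of \<open>F\<close> at \<open>x\<close>, to which
  the word is applied term by term.  When a letter is put in front, the terms in which it forms a
  new block are those in which it differentiates \<open>partials js F\<close>.  Terms beyond the length of the
  word vanish, so any bound \<open>N\<close> from there on serves; the freedom lets all words of one degree
  share a bound.
\<close>

lemma word_op_expansion:
  assumes F: "smooth_map F" and "length w \<le> N"
  shows "word_op w F x =
    (\<Sum>l\<le>N. \<Sum>js | length js = l. block_sum js w x * partials js F x / fact l)"
  using assms(2)
proof (induction w arbitrary: x)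
  case Nil
  have "block_sum js [] x = 0" if "js \<noteq> []" for js
    by (rule block_sum_eq_0) (use that in simp)
  then have "(\<Sum>js | length js = l. block_sum js [] x * partials js F x / fact l) = (if l = 0 then F x else 0)" for l
  proof (cases l)
    case (Suc l')
    then have "block_sum js [] x = 0" if "length js = l" for js
      using that by (intro \<open>\<And>js. js \<noteq> [] \<Longrightarrow> block_sum js [] x = 0\<close>) auto
    with Suc show ?thesis by simp
  qed simp
  then show ?case by simp
next
  case (Cons k w)
  \<comment> \<open>\<open>L\<close>: the letter \<open>k\<close> differentiates \<open>partials js F\<close>; \<open>R\<close>: it forms a new block.\<close>
  define L where "L l = (\<Sum>js | length js = l. \<Sum>i\<in>UNIV. g k x $ i * block_sum js w x * partials (i # js) F x)" for l
  define R where "R l = (\<Sum>js | length js = l. \<Sum>j<l.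
    g k x $ (js ! j) * block_sum (take j js @ drop (Suc j) js) w x * partials js F x)" for l
  have RL: "R (Suc l) = of_nat (Suc l) * L l" for l
    unfolding R_def L_def
    by (rule sum_remove_index[OF F, where A="\<lambda>i js. g k x $ i * block_sum js w x"])
  \<comment> \<open>This makes the sums of \<open>L\<close> and \<open>R\<close>, shifted by one against each other, end at the same place.\<close>
  have "L N = 0"
    unfolding L_def using Cons.prems by (intro sum.neutral ballI) (auto simp: block_sum_eq_0)
  have "(\<Sum>l\<le>N. R l / fact l) = (\<Sum>l<N. R (Suc l) / fact (Suc l))"
    by (cases N) (simp_all add: sum.atMost_Suc_shift R_def lessThan_Suc_atMost del: sum.atMost_Suc)
  also have "\<dots> = (\<Sum>l<N. L l / fact l)"
    by (simp add: RL del: of_nat_Suc)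
  also have "\<dots> = (\<Sum>l\<le>N. L l / fact l)"
    using \<open>L N = 0\<close> by (simp add: lessThan_Suc_atMost[symmetric])
  finally have LR: "(\<Sum>l\<le>N. L l / fact l) = (\<Sum>l\<le>N. R l / fact l)" ..
  have "word_op w F = (\<lambda>x. \<Sum>l\<le>N. \<Sum>js | length js = l. (1 / fact l) * (block_sum js w x * partials js F x))"
    using Cons by (simp add: fun_eq_iff)
  then have "word_op (k # w) F x = (\<Sum>l\<le>N. \<Sum>js | length js = l. (1 / fact l) *
      (lie k (block_sum js w) x * partials js F x + block_sum js w x * lie k (partials js F) x))"
    by (simp add: lie_sum lie_cmult lie_mult smooth_map_sum smooth_map_mult smooth_map_const
        smooth_map_block_sum smooth_map_partials[OF F] del: times_divide_eq_left)
  also have "\<dots> = (\<Sum>l\<le>N. (\<Sum>js | length js = l. lie k (block_sum js w) x * partials js F x / fact l) + L l / fact l)"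
    by (simp add: L_def lie_def sum.distrib sum_distrib_left sum_divide_distrib algebra_simps add_divide_distrib)
  also have "\<dots> = (\<Sum>l\<le>N. (\<Sum>js | length js = l. lie k (block_sum js w) x * partials js F x / fact l) + R l / fact l)"
    using LR by (simp add: sum.distrib)
  also have "\<dots> = (\<Sum>l\<le>N. \<Sum>js | length js = l. block_sum js (k # w) x * partials js F x / fact l)"
  proof (rule sum.cong[OF refl])
    fix l
    have "R l / fact l = (\<Sum>js | length js = l. (\<Sum>j<l. g k x $ (js ! j) *
        block_sum (take j js @ drop (Suc j) js) w x) * partials js F x / fact l)"
      unfolding R_def by (simp add: sum_divide_distrib sum_distrib_right)
    then show "(\<Sum>js | length js = l. lie k (block_sum js w) x * partials js F x / fact l) + R l / fact l =
        (\<Sum>js | length js = l. block_sum js (k # w) x * partials js F x / fact l)"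
      unfolding sum.distrib[symmetric]
      by (auto simp: sum.distrib[symmetric] block_sum_Cons_word distrib_right add_divide_distrib intro!: sum.cong)
  qed
  finally show ?case .
qed

end

section \<open>Substitution into a smooth function\<close>

lemma finite_mset_pairs: "finite {(p, q). p + q = (m :: 'a multiset)}"
proof (rule finite_subset)
  show "{(p, q). p + q = m} \<subseteq> (\<lambda>(u, v). (mset u, mset v)) ` {(u, v). mset u + mset v = m}"
  proof clarify
    fix p q :: "'a multiset" assume "m = p + q"
    moreover obtain u v where "mset u = p" "mset v = q" using ex_mset by metis
    ultimately show "(p, q) \<in> (\<lambda>(u, v). (mset u, mset v)) ` {(u, v). mset u + mset v = p + q}"
      by (intro image_eqI[of _ _ "(u, v)"]) auto
  qed
qed (simp add: finite_word_pairs)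

lemma sum_word_pairs:
  fixes G :: "'a list \<Rightarrow> 'a list \<Rightarrow> 'b::comm_monoid_add"
  shows "(\<Sum>(u, v) | mset u + mset v = m. G u v) =
    (\<Sum>(p, q) | p + q = m. \<Sum>u | mset u = p. \<Sum>v | mset v = q. G u v)"
proof -
  let ?I = "{(p, q). p + q = m}"
  let ?U = "\<lambda>pq. {u. mset u = fst pq} \<times> {v. mset v = snd pq}"
  have "(\<Sum>(u, v) | mset u + mset v = m. G u v) = (\<Sum>(pq, uv)\<in>(SIGMA pq:?I. ?U pq). case_prod G uv)"
  proof (rule sum.reindex_bij_witness[where j="\<lambda>(u, v). ((mset u, mset v), (u, v))" and i=snd], goal_cases)
    case (1 a)
    then show ?case by (cases a) simp
  next
    case (2 a)
    then show ?case by (cases a) simp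
  next
    case (3 b)
    then show ?case by (cases b) (simp add: mem_Times_iff split_beta prod_eq_iff)
  next
    case (4 b)
    then show ?case by (cases b) (simp add: mem_Times_iff split_beta)
  next
    case (5 a)
    then show ?case by (cases a) simp
  qed
  also have "\<dots> = (\<Sum>pq\<in>?I. \<Sum>uv\<in>?U pq. case_prod G uv)"
    by (rule sum.Sigma[OF finite_mset_pairs, symmetric]) (simp add: finite_cartesian_product)
  also have "\<dots> = (\<Sum>(p, q)\<in>?I. \<Sum>u | mset u = p. \<Sum>v | mset v = q. G u v)"
    by (rule sum.cong[OF refl]) (simp add: sum.cartesian_product split_def)
  finally show ?thesis .
qed

lemma mset_take_drop: "mset (take i w) + mset (drop i w) = mset w"
  by (metis append_take_drop_id mset_append)

lemma sum_deconcatenations: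
  fixes G :: "'a list \<Rightarrow> 'a list \<Rightarrow> 'b::comm_monoid_add"
  shows "(\<Sum>w | mset w = m. \<Sum>i\<le>length w. G (take i w) (drop i w)) =
    (\<Sum>(u, v) | mset u + mset v = m. G u v)"
proof -
  have "(\<Sum>w | mset w = m. \<Sum>i\<le>length w. G (take i w) (drop i w)) =
     (\<Sum>(w, i)\<in>(SIGMA w:{w. mset w = m}. {..length w}). G (take i w) (drop i w))"
    by (rule sum.Sigma) auto
  also have "\<dots> = (\<Sum>(u, v) | mset u + mset v = m. G u v)"
  proof (rule sum.reindex_bij_witness[where j="\<lambda>(w, i). (take i w, drop i w)"
        and i="\<lambda>(u, v). (u @ v, length u)"], goal_cases)
    case (1 a)
    then show ?case by (cases a) (simp add: min_absorb2)
  next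
    case (2 a)
    then show ?case by (cases a) (simp add: mset_take_drop)
  next
    case (3 a)
    then show ?case by (cases a) simp
  next
    case (4 a)
    then show ?case by (cases a) simp
  next
    case (5 a)
    then show ?case by (cases a) simp
  qed
  finally show ?thesis .
qed

text \<open>
  The index set of one term of a formal Taylor expansion: the ways to write a monomial as an ordered
  product of \<open>l\<close> monomials, none of them constant.
\<close>

definition proper_lists :: "'a multiset \<Rightarrow> nat \<Rightarrow> 'a multiset list set" where
  "proper_lists m l = {ps. {#} \<notin> set ps \<and> sum_list ps = m \<and> length ps = l}"

lemma length_le_size_sum_list: "{#} \<notin> set ps \<Longrightarrow> length ps \<le> size (sum_list ps)"
  by (induction ps) (auto simp: nonempty_has_size Suc_le_eq)

text \<open>
  Formal substitution sums over this set, and a sum over an infinite set would be \<open>0\<close>.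
\<close>

lemma finite_splittings: "finite {(m0, ps). {#} \<notin> set ps \<and> m0 + sum_list ps = (m :: 'a multiset)}"
proof (rule finite_subset)
  let ?S = "(\<lambda>(p, q). p) ` {(p, q). p + q = m}"
  have S: "p \<in> ?S" if "p \<subseteq># m" for p
    using that by (auto simp: subset_mset.le_iff_add image_iff)
  have sub: "p \<subseteq># sum_list ps" if "p \<in> set ps" for p and ps :: "'a multiset list"
    using that by (induction ps) (auto simp: subset_mset.add_increasing2 subset_mset.add_increasing)
  show "{(m0, ps). {#} \<notin> set ps \<and> m0 + sum_list ps = m} \<subseteq>
      ?S \<times> {ps. set ps \<subseteq> ?S \<and> length ps \<le> size m}"
  proof
    fix z assume "z \<in> {(m0, ps). {#} \<notin> set ps \<and> m0 + sum_list ps = m}"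
    then obtain m0 ps where z: "z = (m0, ps)" and ps: "{#} \<notin> set ps" and m: "m = m0 + sum_list ps"
      by auto
    have "m0 \<in> ?S" unfolding m by (intro image_eqI[of _ _ "(m0, sum_list ps)"]) (auto simp: m)
    moreover have "set ps \<subseteq> ?S"
      using S sub m by (meson mset_subset_eq_add_right subsetI subset_mset.order_trans)
    ultimately show "z \<in> ?S \<times> {ps. set ps \<subseteq> ?S \<and> length ps \<le> size m}"
      using length_le_size_sum_list[OF ps] unfolding z by (simp add: m)
  qed
  have "finite ?S" by (intro finite_imageI finite_mset_pairs)
  then show "finite (?S \<times> {ps. set ps \<subseteq> ?S \<and> length ps \<le> size m})"
    by (intro finite_cartesian_product finite_lists_length_le)
qed

lemma finite_proper_lists: "finite (proper_lists m l)"
  by (rule finite_subset[OF _ finite_imageI[OF finite_splittings[of m], of snd]])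
    (force simp: proper_lists_def)

lemma proper_lists_0: "proper_lists m 0 = (if m = {#} then {[]} else {})"
  by (auto simp: proper_lists_def)

lemma sum_proper_lists_Suc:
  fixes G :: "'a multiset \<Rightarrow> 'a multiset list \<Rightarrow> 'b::comm_monoid_add"
  shows "(\<Sum>ps\<in>proper_lists m (Suc l). G (hd ps) (tl ps)) =
    (\<Sum>(p, q) | p + q = m. if p = {#} then 0 else \<Sum>ps\<in>proper_lists q l. G p ps)"
proof -
  have "(\<Sum>ps\<in>proper_lists m (Suc l). G (hd ps) (tl ps)) =
    (\<Sum>(pq, ps)\<in>(SIGMA pq:{(p, q). p + q = m \<and> p \<noteq> {#}}. proper_lists (snd pq) l). G (fst pq) ps)"
    by (rule sum.reindex_bij_witness[where j="\<lambda>ps. ((hd ps, sum_list (tl ps)), tl ps)"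
          and i="\<lambda>(pq, ps). fst pq # ps"])
      (auto simp: proper_lists_def length_Suc_conv)
  also have "\<dots> = (\<Sum>pq | case pq of (p, q) \<Rightarrow> p + q = m \<and> p \<noteq> {#}. \<Sum>ps\<in>proper_lists (snd pq) l. G (fst pq) ps)"
    by (rule sum.Sigma[symmetric])
      (auto simp: finite_proper_lists intro: finite_subset[OF _ finite_mset_pairs])
  also have "\<dots> = (\<Sum>(p, q) | p + q = m. if p = {#} then 0 else \<Sum>ps\<in>proper_lists q l. G p ps)"
    by (rule sum.mono_neutral_cong_left) (auto simp: finite_mset_pairs)
  finally show ?thesis .
qed

lemma sum_splittings:
  fixes G :: "'a multiset \<Rightarrow> 'a multiset list \<Rightarrow> 'b::comm_monoid_add"
  shows "(\<Sum>(m0, ps) | {#} \<notin> set ps \<and> m0 + sum_list ps = m. G m0 ps) =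
    (\<Sum>(m0, q) | m0 + q = m. \<Sum>l\<le>size m. \<Sum>ps\<in>proper_lists q l. G m0 ps)"
proof -
  have "(\<Sum>(m0, ps) | {#} \<notin> set ps \<and> m0 + sum_list ps = m. G m0 ps) =
     (\<Sum>((m0, q), l, ps)\<in>(SIGMA mq:{(m0, q). m0 + q = m}. SIGMA l:{..size m}. proper_lists (snd mq) l). G m0 ps)"
    by (rule sum.reindex_bij_witness[where j="\<lambda>(m0, ps). ((m0, sum_list ps), length ps, ps)"
          and i="\<lambda>((m0, q), l, ps). (m0, ps)"])
      (auto simp: proper_lists_def intro: order_trans[OF length_le_size_sum_list])
  also have "\<dots> = (\<Sum>mq | case mq of (m0, q) \<Rightarrow> m0 + q = m.
      \<Sum>(l, ps)\<in>(SIGMA l:{..size m}. proper_lists (snd mq) l). G (fst mq) ps)"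
    unfolding split_def
    by (subst sum.Sigma) (simp_all add: finite_proper_lists finite_mset_pairs[unfolded split_def] split_def)
  also have "\<dots> = (\<Sum>(m0, q) | m0 + q = m. \<Sum>l\<le>size m. \<Sum>ps\<in>proper_lists q l. G m0 ps)"
    by (rule sum.cong[OF refl], clarify, subst sum.Sigma[symmetric])
      (simp_all add: finite_proper_lists)
  finally show ?thesis .
qed

context smooth_fields
begin

text \<open>
  The shuffle relations at work: the product of the coefficients \<open>\<gamma> u * \<gamma> v\<close> is the sum of \<open>\<gamma>\<close> over
  the shuffles of \<open>u\<close> and \<open>v\<close>.  Hence a product of word series is again a sum over single words, with
  the Leibniz coefficients \<open>block_sum\<close>.
\<close>

lemma sum_block_sum:
  assumes \<gamma>: "\<gamma> \<in> word_group"
    and \<phi>: "\<And>p i. p \<noteq> {#} \<Longrightarrow> \<phi> p $ i = (\<Sum>w | mset w = p. \<gamma> w * word_coord w i x)"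
  shows "(\<Sum>w | mset w = m. \<gamma> w * block_sum js w x) =
    (\<Sum>ps\<in>proper_lists m (length js). prod_list (map2 (\<lambda>p i. \<phi> p $ i) ps js))"
proof (induction js arbitrary: m)
  case Nil
  have "(\<Sum>w | mset w = m. \<gamma> w * block_sum [] w x) = (\<Sum>w | mset w = m. if w = [] then 1 else 0)"
    using \<gamma> by (intro sum.cong) (auto simp: word_group_def)
  also have "\<dots> = (if m = {#} then 1 else 0)"
    by (cases "m = {#}") (auto intro!: sum.neutral)
  finally show ?case by (simp add: proper_lists_0)
next
  case (Cons i js)
  have sh: "shuffle_sum u v \<gamma> = \<gamma> u * \<gamma> v" for u v
    using \<gamma> by (simp add: word_group_def)
  have \<phi>': "(\<Sum>u | mset u = p. \<gamma> u * increment u i x) = (if p = {#} then 0 else \<phi> p $ i)" for p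
  proof (cases "p = {#}")
    case False
    then have "(\<Sum>u | mset u = p. \<gamma> u * increment u i x) = (\<Sum>u | mset u = p. \<gamma> u * word_coord u i x)"
      by (intro sum.cong) (auto simp: increment_def)
    with False show ?thesis by (simp add: \<phi>)
  qed (simp add: increment_def)
  have "(\<Sum>w | mset w = m. \<gamma> w * block_sum (i # js) w x) =
      (\<Sum>w | mset w = m. \<Sum>(u, v)\<in>#deshuffle w. \<gamma> w * (increment u i x * block_sum js v x))"
    by (simp add: sum_mset_distrib_left split_def)
  also have "\<dots> = (\<Sum>(u, v) | mset u + mset v = m. (\<gamma> u * increment u i x) * (\<gamma> v * block_sum js v x))"
    by (subst sum_deshuffle_eq_sum_shuffle)
      (simp add: sum_mset_distrib_right[symmetric] sh mult_ac)
  also have "\<dots> = (\<Sum>(p, q) | p + q = m. (if p = {#} then 0 else \<phi> p $ i) *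
      (\<Sum>ps\<in>proper_lists q (length js). prod_list (map2 (\<lambda>p i. \<phi> p $ i) ps js)))"
    by (subst sum_word_pairs) (simp add: sum_product[symmetric] \<phi>' Cons.IH)
  also have "\<dots> = (\<Sum>(p, q) | p + q = m. if p = {#} then 0 else
      \<Sum>ps\<in>proper_lists q (length js). \<phi> p $ i * prod_list (map2 (\<lambda>p i. \<phi> p $ i) ps js))"
    by (intro sum.cong) (auto simp: sum_distrib_left)
  also have "\<dots> = (\<Sum>ps\<in>proper_lists m (Suc (length js)).
      \<phi> (hd ps) $ i * prod_list (map2 (\<lambda>p i. \<phi> p $ i) (tl ps) js))"
    by (rule sum_proper_lists_Suc[symmetric])
  also have "\<dots> = (\<Sum>ps\<in>proper_lists m (length (i # js)). prod_list (map2 (\<lambda>p i. \<phi> p $ i) ps (i # js)))"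
    by (intro sum.cong) (auto simp: proper_lists_def length_Suc_conv)
  finally show ?case .
qed

text \<open>
  Substitution is a sum of differential operators: the left-hand side is the Taylor expansion
  of \<open>F\<close> about \<open>x\<close> with the displacement given by \<open>\<phi>\<close>, as in the definition of \<open>formal_comp\<close>, and on
  the right every word acts on \<open>F\<close> as a whole.  The coefficient of \<open>partials js (F m0) x\<close> is given on
  the left by \<open>sum_block_sum\<close> and on the right by \<open>word_op_expansion\<close>.
\<close>

lemma taylor_substitution:
  fixes F :: "'a multiset \<Rightarrow> real ^ 'n \<Rightarrow> complex"
  assumes \<gamma>: "\<gamma> \<in> word_group"
    and \<phi>: "\<And>p i. p \<noteq> {#} \<Longrightarrow> \<phi> p $ i = (\<Sum>w | mset w = p. \<gamma> w * word_coord w i x)"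
    and F: "\<And>m. smooth_map (F m)"
  shows "(\<Sum>(m0, ps) | {#} \<notin> set ps \<and> m0 + sum_list ps = m. \<Sum>js | length js = length ps.
      prod_list (map2 (\<lambda>p i. \<phi> p $ i) ps js) / fact (length ps) * partials js (F m0) x) =
    (\<Sum>(m0, q) | m0 + q = m. \<Sum>w | mset w = q. \<gamma> w * word_op w (F m0) x)"
proof -
  define P where "P ps js = prod_list (map2 (\<lambda>p i. \<phi> p $ i) ps js)" for ps js
  define G where "G m0 ps = (\<Sum>js | length js = length ps. P ps js / fact (length ps) * partials js (F m0) x)"
    for m0 ps
  have *: "(\<Sum>l\<le>size m. \<Sum>ps\<in>proper_lists q l. G m0 ps) = (\<Sum>w | mset w = q. \<gamma> w * word_op w (F m0) x)"
    if m: "m0 + q = m" for m0 q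
  proof -
    have "(\<Sum>ps\<in>proper_lists q l. G m0 ps) =
        (\<Sum>js | length js = l. (\<Sum>w | mset w = q. \<gamma> w * block_sum js w x) * (partials js (F m0) x / fact l))" for l
    proof -
      have "(\<Sum>ps\<in>proper_lists q l. G m0 ps) =
          (\<Sum>ps\<in>proper_lists q l. \<Sum>js | length js = l. P ps js * (partials js (F m0) x / fact l))"
        by (rule sum.cong) (auto simp: proper_lists_def G_def)
      also have "\<dots> = (\<Sum>js | length js = l. (\<Sum>ps\<in>proper_lists q l. P ps js) * (partials js (F m0) x / fact l))"
        unfolding sum_distrib_right by (rule sum.swap)
      also have "\<dots> = (\<Sum>js | length js = l. (\<Sum>w | mset w = q. \<gamma> w * block_sum js w x) * (partials js (F m0) x / fact l))"
      proof (rule sum.cong[OF refl])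
        fix js :: "'n list" assume "js \<in> {js. length js = l}"
        then have "(\<Sum>ps\<in>proper_lists q l. P ps js) = (\<Sum>w | mset w = q. \<gamma> w * block_sum js w x)"
          using sum_block_sum[OF \<gamma>, where \<phi>=\<phi> and x=x and m=q and js=js] \<phi>
          by (simp add: P_def)
        then show "(\<Sum>ps\<in>proper_lists q l. P ps js) * (partials js (F m0) x / fact l) =
          (\<Sum>w | mset w = q. \<gamma> w * block_sum js w x) * (partials js (F m0) x / fact l)" by simp
      qed
      finally show ?thesis .
    qed
    then have "(\<Sum>l\<le>size m. \<Sum>ps\<in>proper_lists q l. G m0 ps) = (\<Sum>l\<le>size m. \<Sum>js | length js = l.
        \<Sum>w | mset w = q. \<gamma> w * (block_sum js w x * partials js (F m0) x / fact l))"
      by (simp only: sum_distrib_right mult.assoc times_divide_eq_right sum_divide_distrib)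
    also have "\<dots> = (\<Sum>l\<le>size m. \<Sum>w | mset w = q. \<Sum>js | length js = l.
        \<gamma> w * (block_sum js w x * partials js (F m0) x / fact l))"
      by (rule sum.cong[OF refl], rule sum.swap)
    also have "\<dots> = (\<Sum>w | mset w = q. \<Sum>l\<le>size m. \<Sum>js | length js = l.
        \<gamma> w * (block_sum js w x * partials js (F m0) x / fact l))"
      by (rule sum.swap)
    also have "\<dots> = (\<Sum>w | mset w = q. \<gamma> w * word_op w (F m0) x)"
    proof (rule sum.cong[OF refl])
      fix w assume "w \<in> {w. mset w = q}"
      then have "length w \<le> size m" using m by auto
      from word_op_expansion[OF F this, of m0 x]
      show "(\<Sum>l\<le>size m. \<Sum>js | length js = l. \<gamma> w * (block_sum js w x * partials js (F m0) x / fact l))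
          = \<gamma> w * word_op w (F m0) x"
        by (simp only: sum_distrib_left)
    qed
    finally show ?thesis .
  qed
  have "(\<Sum>(m0, ps) | {#} \<notin> set ps \<and> m0 + sum_list ps = m. G m0 ps) =
      (\<Sum>(m0, q) | m0 + q = m. \<Sum>l\<le>size m. \<Sum>ps\<in>proper_lists q l. G m0 ps)"
    by (rule sum_splittings)
  also have "\<dots> = (\<Sum>(m0, q) | m0 + q = m. \<Sum>w | mset w = q. \<gamma> w * word_op w (F m0) x)"
    by (rule sum.cong[OF refl]) (use * in force)
  finally show ?thesis unfolding G_def P_def .
qed

text \<open>
  If translation by \<open>U\<close> multiplies the field of each letter by a constant, then it multiplies the
  operators of words by the product of these constants; only the coordinate function itself is
  changed additively.
\<close>

lemma word_coord_shift:
  assumes "\<And>k x i. g k (x + U) $ i = c k * g k x $ i"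
  shows "word_coord w i (x + U) =
    prod_list (map c w) * word_coord w i x + (if w = [] then complex_of_real (U $ i) else 0)"
proof (induction w arbitrary: x)
  case (Cons k w)
  have "partial j (word_coord w i) (x + U) = prod_list (map c w) * partial j (word_coord w i) x" for j
  proof -
    have sm: "smooth_map (word_coord w i)" by (intro smooth_map_word_op smooth_map_coordinate)
    have d: "word_coord w i differentiable at x" for x
      by (rule smooth_map_differentiable[OF sm])
    have dc: "(\<lambda>x. prod_list (map c w) * word_coord w i x) differentiable at x"
      by (intro differentiable_mult differentiable_const d)
    have "partial j (word_coord w i) (x + U) = partial j (\<lambda>x. word_coord w i (x + U)) x"
      by (rule partial_shift[symmetric]) (rule smooth_map_differentiable[OF sm])
    also have "\<dots> = partial j (\<lambda>x. prod_list (map c w) * word_coord w i x) x"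
      unfolding Cons.IH by (subst partial_add[OF dc]) auto
    also have "\<dots> = prod_list (map c w) * partial j (word_coord w i) x"
      by (rule partial_linear[OF bounded_linear_mult_right]) (rule smooth_map_differentiable[OF sm])
    finally show ?thesis .
  qed
  then show ?case
    by (simp add: lie_def assms sum_distrib_left mult_ac)
qed simp

end

section \<open>Composition of extended word series\<close>

text \<open>
  Shifting the argument moves the base point of the expansion to \<open>x\<close>, the form needed by
  \<open>taylor_substitution\<close>.
\<close>

lemma formal_comp_component:
  assumes \<Psi>: "\<And>m. smooth_map (\<Psi> m)" and z: "Re_vec (\<Phi> {#} x) = x + U"
  shows "(\<Psi> \<odot> \<Phi>) m x $ c =
    (\<Sum>(m0, ps) | {#} \<notin> set ps \<and> m0 + sum_list ps = m. \<Sum>js | length js = length ps.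
      prod_list (map2 (\<lambda>p i. \<Phi> p x $ i) ps js) / fact (length ps) *
        partials js (\<lambda>x. \<Psi> m0 (x + U) $ c) x)"
proof -
  have "partials js (\<lambda>x. \<Psi> m0 (x + U) $ c) x = partials js (\<Psi> m0) (x + U) $ c" for js m0
  proof -
    have "partials js (\<lambda>x. \<Psi> m0 (x + U) $ c) = (\<lambda>x. partials js (\<lambda>x. \<Psi> m0 (x + U)) x $ c)"
      by (rule partials_linear[OF bounded_linear_vec_nth smooth_map_shift[OF \<Psi>]])
    then show ?thesis by (simp add: partials_shift[OF \<Psi>])
  qed
  then show ?thesis
    by (simp add: formal_comp_def z split_def)
qed

lemma smooth_map_componentwise:
  fixes F :: "real ^ 'n::finite \<Rightarrow> complex ^ 'm::finite"
  assumes "\<And>i. smooth_map (\<lambda>x. F x $ i)"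
  shows "smooth_map F"
proof -
  have "bounded_linear (\<lambda>c :: complex. axis i c :: complex ^ 'm)" for i
    unfolding linear_conv_bounded_linear[symmetric]
    by (rule linearI) (auto simp: vec_eq_iff axis_def)
  then have "smooth_map (\<lambda>x. \<Sum>i\<in>UNIV. axis i (F x $ i) :: complex ^ 'm)"
    by (intro smooth_map_sum smooth_map_linear[of "axis _"] assms) auto
  also have "(\<lambda>x. \<Sum>i\<in>UNIV. axis i (F x $ i) :: complex ^ 'm) = F"
    by (auto simp: fun_eq_iff vec_eq_iff axis_def)
  finally show ?thesis .
qed

lemma smooth_fields_fourier_mode: "smooth_map f \<Longrightarrow> smooth_fields (fourier_mode \<iota> f)"
  by unfold_locales (rule smooth_map_fourier_mode)

text \<open>
  In the vector-valued recursion of \<open>word_basis\<close> each component is acted on separately, by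
  the same operators.  Smoothness is proved along with it, as the derivative of a vector is taken
  componentwise only where it exists.
\<close>

lemma word_basis_component:
  assumes "smooth_map f"
  shows "smooth_map (word_basis \<iota> f w) \<and>
    (\<forall>x c. word_basis \<iota> f w x $ c =
      smooth_fields.word_op (fourier_mode \<iota> f) w (\<lambda>x. complex_of_real (x $ c)) x)"
proof -
  interpret smooth_fields "fourier_mode \<iota> f"
    by (rule smooth_fields_fourier_mode[OF assms])
  have step: "smooth_map F \<and> (\<forall>x c. F x $ c = word_coord w c x)"
    if "\<And>x c. F x $ c = word_coord w c x" for F w
    using that by (auto intro!: smooth_map_componentwise smooth_map_word_op smooth_map_coordinate)
  have k1: "word_basis \<iota> f [k] x $ c = word_coord [k] c x" for k x c
    by (simp add: lie_def partial_coordinate if_distrib[of "(*) _"] cong: if_cong)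
  show ?thesis
  proof (rule step)
    show "word_basis \<iota> f w x $ c = word_coord w c x" for x c
    proof (induction w arbitrary: x c)
      case (Cons k w)
      show ?case
      proof (cases w)
        case Nil
        then show ?thesis using k1 by simp
      next
        case (Cons l v)
        have IH: "(\<lambda>x. word_basis \<iota> f w x $ c) = word_coord w c" for c
          using Cons.IH by blast
        have "word_basis \<iota> f w differentiable at x"
          using step[OF Cons.IH] smooth_map_differentiable by blast
        from partial_linear[OF bounded_linear_vec_nth this]
        have "partial i (word_basis \<iota> f w) x $ c = partial i (word_coord w c) x" for i
          by (simp add: IH)
        then show ?thesis by (simp add: Cons lie_def)
      qed
    qed (simp add: cvec_def)
  qed
qed

text \<open>
  The Fourier coefficient ignores the angles, so a rotation acts on a mode through its phase
  factor alone.
\<close>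

lemma fourier_mode_shift:
  assumes "inj \<iota>"
  shows "fourier_mode \<iota> f k (x + with_angles \<iota> 0 u) $ i =
    exp (\<i> * complex_of_real (idot k u)) * fourier_mode \<iota> f k x $ i"
proof -
  have "with_angles \<iota> (x + with_angles \<iota> 0 u) \<theta> = with_angles \<iota> x \<theta>" for \<theta>
    by (auto simp: with_angles_def vec_eq_iff)
  then have "fourier_coeff \<iota> f k (x + with_angles \<iota> 0 u) = fourier_coeff \<iota> f k x"
    by (simp add: fourier_coeff_def)
  moreover have "angles \<iota> (x + with_angles \<iota> 0 u) = angles \<iota> x + u"
    using assms by (auto simp: angles_def with_angles_def vec_eq_iff)
  moreover have "idot k (angles \<iota> x + u) = idot k (angles \<iota> x) + idot k u"
    by (rule linear_add[OF bounded_linear.linear[OF bounded_linear_idot]])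
  ultimately show ?thesis
    by (simp add: fourier_mode_def exp_add distrib_left)
qed

lemma angle_embed_cvec: "angle_embed \<iota> (cvec u) = cvec (with_angles \<iota> 0 u)"
  by (auto simp: angle_embed_def cvec_def with_angles_def vec_eq_iff)

lemma cvec_add: "cvec (x + y) = cvec x + cvec y"
  by (simp add: cvec_def vec_eq_iff)

lemma Re_vec_cvec: "Re_vec (cvec x) = x"
  by (simp add: cvec_def Re_vec_def vec_eq_iff)

text \<open>
  The composition rule.  By \<open>taylor_substitution\<close> the inner series acts on the coefficients
  of the outer one through word operators, and operators of words compose by concatenation; the
  sum over pairs of words is thus a sum over the cuts of a word.  The rotation by \<open>u\<close> contributes the
  twist.
\<close>

lemma ext_word_series_comp:
  fixes \<iota> :: "'a::finite \<Rightarrow> 'b::finite"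
  assumes \<iota>: "inj \<iota>" and f: "smooth_map f" and \<gamma>: "\<gamma> \<in> word_group"
  shows "ext_word_series \<iota> f v \<delta> \<odot> ext_word_series \<iota> f (cvec u) \<gamma> =
    ext_word_series \<iota> f (v + \<delta> [] *s cvec u) (\<gamma> \<star> word_twist u \<delta>)"
proof (intro ext, subst vec_eq_iff, rule allI)
  fix m x c
  interpret smooth_fields "fourier_mode \<iota> f"
    by (rule smooth_fields_fourier_mode[OF f])
  define U where "U = with_angles \<iota> 0 u"
  define W where "W = ext_word_series \<iota> f (cvec u) \<gamma>"
  define D where "D = ext_word_series \<iota> f v \<delta>"
  have \<gamma>0: "\<gamma> [] = 1" using \<gamma> by (simp add: word_group_def)
  have wb: "word_basis \<iota> f w x $ c = word_coord w c x" and sm: "smooth_map (word_basis \<iota> f w)"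
    for w x c using word_basis_component[OF f] by auto
  have "Re_vec (W {#} x) = x + U"
    by (simp add: W_def ext_word_series_def angle_embed_cvec U_def cvec_add[symmetric] Re_vec_cvec
        add.commute \<gamma>0)
  moreover have smD: "smooth_map (D m)" for m
  proof -
    have "bounded_linear (\<lambda>z :: complex ^ 'b. a *s z)" for a
      unfolding linear_conv_bounded_linear[symmetric]
      by (rule linearI) (auto simp: vec_eq_iff algebra_simps)
    then show ?thesis unfolding D_def ext_word_series_def
      by (intro smooth_map_add smooth_map_const smooth_map_sum finite_words smooth_map_linear[of "(*s) _"] sm)
  qed
  ultimately have "(D \<odot> W) m x $ c =
    (\<Sum>(m0, ps) | {#} \<notin> set ps \<and> m0 + sum_list ps = m. \<Sum>js | length js = length ps.
      prod_list (map2 (\<lambda>p i. W p x $ i) ps js) / fact (length ps) *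
        partials js (\<lambda>x. D m0 (x + U) $ c) x)"
    by (intro formal_comp_component)
  also have "\<dots> = (\<Sum>(m0, q) | m0 + q = m. \<Sum>w | mset w = q. \<gamma> w * word_op w (\<lambda>x. D m0 (x + U) $ c) x)"
  proof (rule taylor_substitution[OF \<gamma>])
    show "W p x $ i = (\<Sum>w | mset w = p. \<gamma> w * word_coord w i x)" if "p \<noteq> {#}" for p i
      using that by (simp add: W_def ext_word_series_def wb)
    show "smooth_map (\<lambda>x. D m0 (x + U) $ c)" for m0
      by (intro smooth_map_linear[OF bounded_linear_vec_nth] smooth_map_shift smD)
  qed
  also have "\<dots> = (\<Sum>(m0, q) | m0 + q = m. \<Sum>w | mset w = q. \<gamma> w *
     ((\<Sum>z | mset z = m0. word_twist u \<delta> z * word_coord (w @ z) c x) +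
      (if w = [] then if m0 = {#} then (angle_embed \<iota> v + \<delta> [] *s cvec U) $ c else 0 else 0)))"
  proof -
    have "D m0 (x + U) $ c = (\<Sum>z | mset z = m0. word_twist u \<delta> z * word_coord z c x) +
      (if m0 = {#} then (angle_embed \<iota> v + \<delta> [] *s cvec U) $ c else 0)" for m0 x
    proof -
      have "word_coord z c (x + U) = exp (\<i> * complex_of_real (\<Sum>k\<leftarrow>z. idot k u)) * word_coord z c x
         + (if z = [] then complex_of_real (U $ c) else 0)" for z
      proof -
        have "prod_list (map (\<lambda>k. exp (\<i> * complex_of_real (idot k u))) z) = exp (\<i> * complex_of_real (\<Sum>k\<leftarrow>z. idot k u))"
          by (induction z) (auto simp: exp_add distrib_left)
        with word_coord_shift[of U "\<lambda>k. exp (\<i> * complex_of_real (idot k u))" z c x]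
        show ?thesis by (simp add: fourier_mode_shift[OF \<iota>] U_def)
      qed
      then have "(\<Sum>z | mset z = m0. \<delta> z * word_coord z c (x + U)) =
         (\<Sum>z | mset z = m0. word_twist u \<delta> z * word_coord z c x + (if z = [] then \<delta> [] * complex_of_real (U $ c) else 0))"
        by (intro sum.cong refl) (auto simp: word_twist_def algebra_simps)
      also have "\<dots> = (\<Sum>z | mset z = m0. word_twist u \<delta> z * word_coord z c x) +
          (if m0 = {#} then \<delta> [] * complex_of_real (U $ c) else 0)"
        by (cases "m0 = {#}") (auto simp: sum.distrib intro!: sum.neutral)
      finally show ?thesis
        by (simp add: D_def ext_word_series_def wb cvec_def)
    qed
    moreover have "smooth_map (word_coord z c)" for z by (intro smooth_map_word_op smooth_map_coordinate)
    ultimately show ?thesis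
      by (simp add: word_op_add word_op_sum word_op_cmult word_op_const word_op_append smooth_map_sum
        smooth_map_mult smooth_map_const)
  qed
  also have "\<dots> = (\<Sum>(m0, q) | m0 + q = m. \<Sum>w | mset w = q. \<Sum>z | mset z = m0.
      \<gamma> w * word_twist u \<delta> z * word_coord (w @ z) c x) + 
     (\<Sum>(m0, q) | m0 + q = m. if m0 = {#} \<and> q = {#} then (angle_embed \<iota> v + \<delta> [] *s cvec U) $ c else 0)"
    unfolding sum.distrib[symmetric] 
  proof (intro sum.cong refl, clarify)
    fix m0 q :: "(int ^ 'a) multiset"
    let ?C = "(angle_embed \<iota> v + \<delta> [] *s cvec U) $ c"
    have "(\<Sum>w | mset w = q. \<gamma> w * (if w = [] then if m0 = {#} then ?C else 0 else 0)) = (if m0 = {#} \<and> q = {#} then ?C else 0)"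
      by (cases "q = {#}") (auto simp: \<gamma>0 intro!: sum.neutral)
    then show "(\<Sum>w | mset w = q. \<gamma> w * ((\<Sum>z | mset z = m0. word_twist u \<delta> z * word_coord (w @ z) c x) +
      (if w = [] then if m0 = {#} then ?C else 0 else 0))) = (\<Sum>w | mset w = q. \<Sum>z | mset z = m0.
      \<gamma> w * word_twist u \<delta> z * word_coord (w @ z) c x) + (if m0 = {#} \<and> q = {#} then ?C else 0)"
      by (simp add: distrib_left sum.distrib sum_distrib_left mult.assoc del: vector_add_component)
  qed
  also have "(\<Sum>(m0, q) | m0 + q = m. if m0 = {#} \<and> q = {#} then (angle_embed \<iota> v + \<delta> [] *s cvec U) $ c else 0)
     = (if m = {#} then (angle_embed \<iota> v + \<delta> [] *s cvec U) $ c else 0)"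
  proof -
    let ?C = "(angle_embed \<iota> v + \<delta> [] *s cvec U) $ c"
    have "(\<Sum>(m0, q) | m0 + q = m. if m0 = {#} \<and> q = {#} then ?C else 0) =
        (\<Sum>pq\<in>{(m0, q). m0 + q = m}. if pq = ({#}, {#}) then ?C else 0)"
      by (rule sum.cong[OF refl]) (simp add: split_beta prod_eq_iff)
    also have "\<dots> = (if m = {#} then ?C else 0)"
      by (subst sum.delta[OF finite_mset_pairs]) auto
    finally show ?thesis .
  qed
  also have "(\<Sum>(m0, q) | m0 + q = m. \<Sum>w | mset w = q. \<Sum>z | mset z = m0.
      \<gamma> w * word_twist u \<delta> z * word_coord (w @ z) c x)
    = (\<Sum>(p, q) | p + q = m. \<Sum>w | mset w = p. \<Sum>z | mset z = q.
      \<gamma> w * word_twist u \<delta> z * word_coord (w @ z) c x)"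
    by (rule sum.reindex_bij_witness[where i=prod.swap and j=prod.swap]) (auto simp: add.commute)
  also have "\<dots> = (\<Sum>w | mset w = m. (\<gamma> \<star> word_twist u \<delta>) w * word_coord w c x)"
    unfolding sum_word_pairs[symmetric] sum_deconcatenations[symmetric]
    by (simp add: word_conv_def sum_distrib_right)
  also have "\<dots> + (if m = {#} then (angle_embed \<iota> v + \<delta> [] *s cvec U) $ c else 0) =
      ext_word_series \<iota> f (v + \<delta> [] *s cvec u) (\<gamma> \<star> word_twist u \<delta>) m x $ c"
    by (simp add: ext_word_series_def wb U_def cvec_def angle_embed_def with_angles_def)
  finally show "(ext_word_series \<iota> f v \<delta> \<odot> ext_word_series \<iota> f (cvec u) \<gamma>) m x $ c = ext_word_series \<iota> f (v + \<delta> [] *s cvec u) (\<gamma> \<star> word_twist u \<delta>) m x $ c"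
    unfolding D_def W_def .
qed

section \<open>Formal flows\<close>

text \<open>
  If the coefficient of the constant monomial of \<open>V\<close> is a constant function, \<open>\<Phi>\<close> enters only through
  terms that use up part of \<open>m\<close> in a non-constant monomial of \<open>V\<close>.  Hence the coefficient of \<open>m\<close> depends
  only on smaller monomials, and a flow can be determined recursively.
\<close>

lemma formal_comp_cong:
  fixes V \<Phi> \<Phi>' :: "('d::finite, 'n::finite) formal_map"
  assumes V: "V {#} = (\<lambda>x. c)"
    and eq: "\<And>p. p \<subset># m \<Longrightarrow> \<Phi> p x = \<Phi>' p x"
  shows "(V \<odot> \<Phi>) m x = (V \<odot> \<Phi>') m x"
  unfolding formal_comp_def
proof (rule sum.cong[OF refl], clarify)
  fix m0 :: "(int ^ 'd) multiset" and ps assume ps: "{#} \<notin> set ps" and m: "m = m0 + sum_list ps"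
  show "(\<Sum>js | length js = length ps.
      (prod_list (map2 (\<lambda>p i. \<Phi> p x $ i) ps js) / fact (length ps)) *s
        partials js (V m0) (Re_vec (\<Phi> {#} x))) =
    (\<Sum>js | length js = length ps.
      (prod_list (map2 (\<lambda>p i. \<Phi>' p x $ i) ps js) / fact (length ps)) *s
        partials js (V m0) (Re_vec (\<Phi>' {#} x)))"
  proof (cases "m0 = {#}")
    case True
    show ?thesis
    proof (rule sum.cong[OF refl], clarify)
      fix js :: "'n list" assume js: "length js = length ps"
      show "(prod_list (map2 (\<lambda>p i. \<Phi> p x $ i) ps js) / fact (length ps)) *s
          partials js (V m0) (Re_vec (\<Phi> {#} x)) =
        (prod_list (map2 (\<lambda>p i. \<Phi>' p x $ i) ps js) / fact (length ps)) *s
          partials js (V m0) (Re_vec (\<Phi>' {#} x))"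
        using js by (cases "js = []") (auto simp: True V partials_const)
    qed
  next
    case False
    have sub: "p \<subseteq># sum_list qs" if "p \<in> set qs" for p and qs :: "(int ^ 'd) multiset list"
      using that by (induction qs) (auto simp: subset_mset.add_increasing2 subset_mset.add_increasing)
    have lt: "\<Phi> p x = \<Phi>' p x" if "p \<subseteq># sum_list ps" for p
    proof (rule eq)
      have "sum_list ps \<subset># m" using False m by (simp add: subset_mset.less_le)
      with that show "p \<subset># m" by (rule subset_mset.le_less_trans)
    qed
    have mp: "map2 (\<lambda>p i. \<Phi> p x $ i) ps js = map2 (\<lambda>p i. \<Phi>' p x $ i) ps js" for js
      by (rule map_cong[OF refl]) (auto dest!: set_zip_leftD intro!: arg_cong[where f="\<lambda>v. v $ _"] lt sub)
    show ?thesis by (simp only: mp lt[of "{#}", OF subset_mset.zero_le])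
  qed
qed

text \<open>
  By induction on the size of the monomial, two flows have the same derivative in each coefficient,
  and both start at the identity.
\<close>

lemma formal_flow_unique:
  assumes V: "V {#} = (\<lambda>x. c)" and flows: "formal_flow V \<Phi>" "formal_flow V \<Phi>'"
  shows "\<Phi> = \<Phi>'"
proof -
  have "\<Phi> t m x = \<Phi>' t m x" for t m x
  proof (induction m arbitrary: t rule: measure_induct_rule[of size])
    case (less m)
    then have IH: "\<Phi> t p x = \<Phi>' t p x" if "p \<subset># m" for t p
      using that less by (simp add: mset_subset_size)
    have "((\<lambda>s. \<Phi> s m x - \<Phi>' s m x) has_vector_derivative 0) (at t)" for t
    proof -
      have "((\<lambda>s. \<Phi> s m x - \<Phi>' s m x) has_vector_derivative
          ((V \<odot> \<Phi> t) m x - (V \<odot> \<Phi>' t) m x)) (at t)"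
        using flows by (intro has_vector_derivative_diff) (auto simp: formal_flow_def)
      moreover have "(V \<odot> \<Phi> t) m x = (V \<odot> \<Phi>' t) m x"
        by (rule formal_comp_cong[where V=V and c=c, OF V]) (rule IH)
      ultimately show ?thesis by simp
    qed
    then have "\<Phi> t m x - \<Phi>' t m x = \<Phi> 0 m x - \<Phi>' 0 m x"
      using has_vector_derivative_zero_constant[of UNIV "\<lambda>s. \<Phi> s m x - \<Phi>' s m x"] by auto metis
    then show ?case using flows by (simp add: formal_flow_def)
  qed
  then show ?thesis by (intro ext)
qed

lemma angle_embed_cvec_zero: "angle_embed \<iota> (cvec 0) = 0"
  by (auto simp: angle_embed_def cvec_def vec_eq_iff)

lemma formal_id_eq: "formal_id = ext_word_series \<iota> f (cvec 0) word_unit"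
proof (intro ext)
  fix m :: "(int ^ 'a) multiset" and x :: "real ^ 'b"
  have "(\<Sum>w | mset w = m. word_unit w *s word_basis \<iota> f w x) = (if m = {#} then cvec x else 0)"
    by (cases "m = {#}") (auto simp: word_unit_def intro!: sum.neutral)
  then show "formal_id m x = ext_word_series \<iota> f (cvec 0) word_unit m x"
    by (simp add: formal_id_def ext_word_series_def angle_embed_cvec_zero)
qed

lemma cvec_scaleR: "cvec (t *\<^sub>R x) = t *\<^sub>R cvec x"
  by (simp add: cvec_def vec_eq_iff scaleR_conv_of_real[where 'a=complex])

lemma angle_embed_scaleR: "angle_embed \<iota> (t *\<^sub>R v) = t *\<^sub>R angle_embed \<iota> v"
  by (simp add: angle_embed_def vec_eq_iff)

lemma rotation_field_eq: "rotation_field \<iota> \<omega> = ext_word_series \<iota> f (cvec \<omega>) (\<lambda>_. 0)"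
  by (simp add: fun_eq_iff rotation_field_def ext_word_series_def)

text \<open>
  The rotation field is itself an extended word series, with no words, so that the composition rule
  evaluates the right-hand side of the flow equation; the same holds in \<open>perturbation_flow\<close>.
\<close>

lemma rotation_flow:
  assumes \<iota>: "inj \<iota>" and f: "smooth_map f"
  shows "formal_flow (rotation_field \<iota> \<omega>) (\<lambda>t. ext_word_series \<iota> f (cvec (t *\<^sub>R \<omega>)) word_unit)"
  unfolding formal_flow_def
proof (intro conjI allI)
  show "ext_word_series \<iota> f (cvec (0 *\<^sub>R \<omega>)) word_unit = formal_id"
    by (simp add: formal_id_eq[of \<iota> f])
  fix t m x
  have "rotation_field \<iota> \<omega> \<odot> ext_word_series \<iota> f (cvec (t *\<^sub>R \<omega>)) word_unit = rotation_field \<iota> \<omega>"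
    unfolding rotation_field_eq[of \<iota> \<omega> f] ext_word_series_comp[OF \<iota> f word_unit_group]
    by (simp add: word_conv_def word_twist_def ext_word_series_def fun_eq_iff)
  moreover have "((\<lambda>s. ext_word_series \<iota> f (cvec (s *\<^sub>R \<omega>)) word_unit m x) has_vector_derivative
      rotation_field \<iota> \<omega> m x) (at t)"
  proof -
    have "(\<lambda>s. ext_word_series \<iota> f (cvec (s *\<^sub>R \<omega>)) word_unit m x) =
      (\<lambda>s. s *\<^sub>R rotation_field \<iota> \<omega> m x + (\<Sum>w | mset w = m. word_unit w *s word_basis \<iota> f w x))"
      by (simp add: ext_word_series_def rotation_field_def cvec_scaleR angle_embed_scaleR)
    then show ?thesis by (auto intro!: derivative_eq_intros)
  qed
  ultimately show "((\<lambda>s. ext_word_series \<iota> f (cvec (s *\<^sub>R \<omega>)) word_unit m x) has_vector_derivative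
      (rotation_field \<iota> \<omega> \<odot> ext_word_series \<iota> f (cvec (t *\<^sub>R \<omega>)) word_unit) m x) (at t)"
    by simp
qed

text \<open>
  The words of one letter carry the vector field \<open>f\<close>.
\<close>

definition letter_indicator :: "'a list \<Rightarrow> complex" where
  "letter_indicator w = (if length w = 1 then 1 else 0)"

lemma perturbation_field_eq: "perturbation_field \<iota> f = ext_word_series \<iota> f (cvec 0) letter_indicator"
proof (intro ext)
  fix m :: "(int ^ 'a) multiset" and x
  have "(\<Sum>w | mset w = m. letter_indicator w *s word_basis \<iota> f w x) =
    (if size m = 1 then \<Sum>k\<in>#m. fourier_mode \<iota> f k x else 0)"
  proof (cases "size m = 1")
    case True
    then obtain k where "m = {#k#}" using size_1_singleton_mset by blast
    then show ?thesis by (simp add: letter_indicator_def)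
  next
    case False
    then show ?thesis by (auto simp: letter_indicator_def intro!: sum.neutral)
  qed
  then show "perturbation_field \<iota> f m x = ext_word_series \<iota> f (cvec 0) letter_indicator m x"
    by (simp add: perturbation_field_def ext_word_series_def angle_embed_cvec_zero)
qed

lemma idot_zero: "idot k 0 = 0"
  by (simp add: idot_def)

lemma word_twist_zero [simp]: "word_twist 0 \<delta> = \<delta>"
  by (simp add: word_twist_def fun_eq_iff idot_zero)

lemma word_exp_derivative:
  "((\<lambda>s. word_exp s w) has_vector_derivative (word_exp t \<star> letter_indicator) w) (at t)"
proof (cases "length w")
  case 0
  then show ?thesis by (simp add: word_exp_def word_conv_def letter_indicator_def)
next
  case (Suc n)
  have "(word_exp t \<star> letter_indicator) w = (\<Sum>i\<le>Suc n. if i = n then complex_of_real (t ^ n / fact n) else 0)"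
    unfolding word_conv_def Suc
    by (rule sum.cong[OF refl]) (use Suc in \<open>auto simp: word_exp_def letter_indicator_def min_def\<close>)
  also have "\<dots> = complex_of_real (t ^ n / fact n)" by simp
  finally have *: "(word_exp t \<star> letter_indicator) w = complex_of_real (t ^ n / fact n)" .
  have "((\<lambda>s. s ^ Suc n / fact (Suc n)) has_real_derivative t ^ n / fact n) (at t)"
    using DERIV_cdivide[OF DERIV_pow[of "Suc n" t UNIV], of "fact (Suc n)"]
    by (simp del: of_nat_Suc power_Suc)
  then show ?thesis
    unfolding * word_exp_def Suc has_real_derivative_iff_has_vector_derivative
    by (rule bounded_linear.has_vector_derivative[OF bounded_linear_of_real])
qed

lemma perturbation_flow:
  fixes \<iota> :: "'a::finite \<Rightarrow> 'b::finite"
  assumes \<iota>: "inj \<iota>" and f: "smooth_map f"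
  shows "formal_flow (perturbation_field \<iota> f) (\<lambda>t. ext_word_series \<iota> f (cvec 0) (word_exp t))"
  unfolding formal_flow_def
proof (intro conjI allI)
  have "word_exp 0 = (word_unit :: 'a word \<Rightarrow> complex)" by (auto simp: word_exp_def word_unit_def fun_eq_iff)
  then show "ext_word_series \<iota> f (cvec 0) (word_exp 0) = formal_id"
    by (simp add: formal_id_eq[of \<iota> f])
  fix t m x
  have "perturbation_field \<iota> f \<odot> ext_word_series \<iota> f (cvec 0) (word_exp t) =
      ext_word_series \<iota> f (cvec 0) (word_exp t \<star> letter_indicator)"
    unfolding perturbation_field_eq ext_word_series_comp[OF \<iota> f word_exp_group]
    by (simp add: letter_indicator_def)
  moreover have "((\<lambda>s. ext_word_series \<iota> f (cvec 0) (word_exp s) m x) has_vector_derivative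
      ext_word_series \<iota> f (cvec 0) (word_exp t \<star> letter_indicator) m x) (at t)"
  proof -
    have "bounded_linear (\<lambda>a. a *s v)" for v :: "complex ^ 'b"
      unfolding linear_conv_bounded_linear[symmetric]
      by (rule linearI) (auto simp: vec_eq_iff algebra_simps)
    from bounded_linear.has_vector_derivative[OF this word_exp_derivative]
    show ?thesis
      by (simp add: ext_word_series_def angle_embed_cvec_zero) (auto intro!: has_vector_derivative_sum)
  qed
  ultimately show "((\<lambda>s. ext_word_series \<iota> f (cvec 0) (word_exp s) m x) has_vector_derivative
      (perturbation_field \<iota> f \<odot> ext_word_series \<iota> f (cvec 0) (word_exp t)) m x) (at t)"
    by simp
qed

section \<open>Coefficients of the splitting integrator\<close>

text \<open>
  The recursion that the composition rule yields for the coefficients of the integrator: step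
  \<open>r + 1\<close> evaluates the perturbation after a total rotation by \<open>h c\<^sub>r\<^sub>+\<^sub>1 \<omega>\<close>.
\<close>

primrec splitting_coeff :: "real ^ 'd::finite \<Rightarrow> (nat \<Rightarrow> real) \<Rightarrow> (nat \<Rightarrow> real) \<Rightarrow> real \<Rightarrow> nat \<Rightarrow> 'd word \<Rightarrow> complex" where
  "splitting_coeff \<omega> a b h 0 = word_unit"
| "splitting_coeff \<omega> a b h (Suc r) = splitting_coeff \<omega> a b h r \<star>
    word_twist ((h * (\<Sum>j = 1..Suc r. a j)) *\<^sub>R \<omega>) (word_exp (b (Suc r) * h))"

lemma splitting_coeff_group: "splitting_coeff \<omega> a b h r \<in> word_group"
  by (induction r) (auto intro: word_unit_group word_conv_group word_twist_group word_exp_group)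

lemma splitting_integrator_eq:
  fixes \<iota> :: "'a::finite \<Rightarrow> 'b::finite"
  assumes \<iota>: "inj \<iota>" and f: "smooth_map f"
    and U: "formal_flow (rotation_field \<iota> \<omega>) \<Phi>U"
    and P: "formal_flow (perturbation_field \<iota> f) \<Phi>P"
  shows "splitting_integrator \<Phi>U \<Phi>P a b h r =
    ext_word_series \<iota> f (cvec ((h * (\<Sum>j = 1..r. a j)) *\<^sub>R \<omega>)) (splitting_coeff \<omega> a b h r)"
proof -
  have U': "\<Phi>U = (\<lambda>t. ext_word_series \<iota> f (cvec (t *\<^sub>R \<omega>)) word_unit)"
    by (rule formal_flow_unique[OF _ U rotation_flow[OF \<iota> f]])
      (simp add: rotation_field_def fun_eq_iff)
  have P': "\<Phi>P = (\<lambda>t. ext_word_series \<iota> f (cvec 0) (word_exp t))"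
    by (rule formal_flow_unique[OF _ P perturbation_flow[OF \<iota> f]])
      (simp add: perturbation_field_def fun_eq_iff)
  show ?thesis
  proof (induction r)
    case 0
    then show ?case by (simp add: formal_id_eq[of \<iota> f])
  next
    case (Suc r)
    have "(word_unit :: 'a word \<Rightarrow> complex) [] *s v = v" "(word_exp t :: 'a word \<Rightarrow> complex) [] *s v = v" for v :: "complex ^ 'a" and t
      by (simp_all add: word_unit_def word_exp_def)
    moreover have "cvec ((a (Suc r) * h) *\<^sub>R \<omega>) + cvec ((h * (\<Sum>j = 1..r. a j)) *\<^sub>R \<omega>) =
        cvec ((h * (\<Sum>j = 1..Suc r. a j)) *\<^sub>R \<omega>)"
      by (simp add: cvec_add[symmetric] algebra_simps flip: scaleR_add_left)
    moreover have "cvec 0 + v = v" for v :: "complex ^ 'a"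
      by (simp add: cvec_def vec_eq_iff)
    ultimately show ?case
      unfolding splitting_integrator.simps Suc.IH unfolding U' P'
      by (simp only: ext_word_series_comp[OF \<iota> f splitting_coeff_group]
        word_twist_unit word_conv_unit splitting_coeff.simps)
  qed
qed

text \<open>
  The summand of \<open>alpha_tilde\<close> at \<open>js\<close>, with the power of \<open>h\<close> included.
\<close>

definition alpha_term ::
  "real ^ 'd::finite \<Rightarrow> (nat \<Rightarrow> real) \<Rightarrow> (nat \<Rightarrow> real) \<Rightarrow> real \<Rightarrow> nat list \<Rightarrow> 'd word \<Rightarrow> complex" where
  "alpha_term \<omega> a b h js ks = complex_of_real (h ^ length ks) *
     (complex_of_real ((\<Prod>l<length ks. b (js ! l)) / real (sigma js)) *
      exp (\<i> * complex_of_real ((\<Sum>l<length ks. (\<Sum>i = 1..js ! l. a i) * idot (ks ! l) \<omega>) * h)))"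

definition step_lists :: "nat \<Rightarrow> nat \<Rightarrow> nat list set" where
  "step_lists r n = {js. length js = n \<and> sorted js \<and> set js \<subseteq> {1..r}}"

lemma alpha_tilde_eq: "alpha_tilde \<omega> a b r h ks = (\<Sum>js\<in>step_lists r (length ks). alpha_term \<omega> a b h js ks)"
proof (cases "ks = []")
  case True
  have "step_lists r 0 = {[]}" by (auto simp: step_lists_def)
  with True show ?thesis by (simp add: alpha_tilde_def alpha_term_def)
qed (simp add: alpha_tilde_def alpha_term_def step_lists_def sum_distrib_left Let_def)

lemma takeWhile_append_replicate:
  assumes "c \<notin> set xs" "j \<noteq> c"
  shows "takeWhile ((=) j) (xs @ replicate l c) = takeWhile ((=) j) xs"
    and "dropWhile ((=) j) (xs @ replicate l c) = dropWhile ((=) j) xs @ replicate l c"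
  using assms by (induction xs) (auto simp: takeWhile_replicate dropWhile_replicate)

text \<open>
  A final run of a new index contributes the factorial of its length; the last step of the
  integrator supplies exactly such a run.
\<close>

lemma sigma_append_replicate:
  assumes "c \<notin> set js"
  shows "sigma (js @ replicate l c) = sigma js * fact l"
  using assms
proof (induction js rule: sigma.induct)
  case 1
  then show ?case by (cases l) (auto simp: takeWhile_replicate dropWhile_replicate)
next
  case (2 j js)
  then have "c \<notin> set (dropWhile ((=) j) (j # js))" by (auto dest: set_dropWhileD)
  with 2 show ?case by (simp add: takeWhile_append_replicate)
qed

text \<open>
  A non-decreasing list with entries up to \<open>r + 1\<close> is one with entries up to \<open>r\<close> followed by a run of
  \<open>r + 1\<close>; the length \<open>i\<close> of the first part is where the convolution cuts the word.
\<close>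

lemma step_lists_Suc:
  fixes G :: "nat list \<Rightarrow> complex"
  shows "(\<Sum>js\<in>step_lists (Suc r) n. G js) =
    (\<Sum>i\<le>n. \<Sum>js\<in>step_lists r i. G (js @ replicate (n - i) (Suc r)))"
proof -
  have fin: "finite (step_lists r i)" for i
    by (rule finite_subset[OF _ finite_lists_length_eq[of "{1..r}" i]]) (auto simp: step_lists_def)
  have tw: "js = takeWhile (\<lambda>j. j \<noteq> Suc r) js @ replicate (n - length (takeWhile (\<lambda>j. j \<noteq> Suc r) js)) (Suc r)"
    if "js \<in> step_lists (Suc r) n" for js
  proof -
    have "sorted js" "set js \<subseteq> {1..Suc r}" "length js = n" using that by (auto simp: step_lists_def)
    then show ?thesis
    proof (induction js arbitrary: n)
      case (Cons j js)
      show ?case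
      proof (cases "j = Suc r")
        case True
        then have "\<forall>x\<in>set js. x = Suc r" using Cons.prems by fastforce
        then have "js = replicate (length js) (Suc r)" by (simp add: replicate_length_same)
        then show ?thesis using True Cons.prems by auto
      qed (use Cons in auto)
    qed simp
  qed
  have "(\<Sum>js\<in>step_lists (Suc r) n. G js) =
    (\<Sum>(i, js)\<in>(SIGMA i:{..n}. step_lists r i). G (js @ replicate (n - i) (Suc r)))"
  proof (rule sum.reindex_bij_witness[where j="\<lambda>js. (length (takeWhile (\<lambda>j. j \<noteq> Suc r) js), takeWhile (\<lambda>j. j \<noteq> Suc r) js)"
        and i="\<lambda>(i, js). js @ replicate (n - i) (Suc r)"], goal_cases)
    case (1 js)
    then show ?case using tw by simp
  next
    case (2 js)
    have "sorted (takeWhile (\<lambda>j. j \<noteq> Suc r) js)"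
      using 2 by (auto simp: step_lists_def intro: sorted_takeWhile)
    moreover have "set (takeWhile (\<lambda>j. j \<noteq> Suc r) js) \<subseteq> {1..r}"
      using 2 by (force simp: step_lists_def dest: set_takeWhileD)
    moreover have "length (takeWhile (\<lambda>j. j \<noteq> Suc r) js) \<le> n"
      using 2 length_takeWhile_le[of _ js] by (auto simp: step_lists_def)
    ultimately show ?case by (auto simp: step_lists_def)
  next
    case (3 b)
    then obtain i js where b: "b = (i, js)" "i \<le> n" "js \<in> step_lists r i" by auto
    then have "\<forall>x\<in>set js. x \<noteq> Suc r" by (force simp: step_lists_def)
    then have "takeWhile (\<lambda>j. j \<noteq> Suc r) (js @ replicate l (Suc r)) = js" for l
      by (simp add: takeWhile_append2 takeWhile_replicate)
    with b show ?case by (simp add: step_lists_def)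
  next
    case (4 b)
    then show ?case by (fastforce simp: step_lists_def sorted_append)
  next
    case (5 js)
    then show ?case using tw by simp
  qed
  also have "\<dots> = (\<Sum>i\<le>n. \<Sum>js\<in>step_lists r i. G (js @ replicate (n - i) (Suc r)))"
    by (rule sum.Sigma[symmetric]) (auto simp: fin)
  finally show ?thesis .
qed

text \<open>
  The last \<open>n - i\<close> letters all meet the index \<open>r + 1\<close>: they collect the power of \<open>b\<^sub>r\<^sub>+\<^sub>1 h\<close>, the
  factorial and the phase at \<open>c\<^sub>r\<^sub>+\<^sub>1\<close>, that is, the twisted exponential.
\<close>

lemma alpha_term_append:
  assumes "js \<in> step_lists r i" "i \<le> length ks"
  shows "alpha_term \<omega> a b h (js @ replicate (length ks - i) (Suc r)) ks =
    alpha_term \<omega> a b h js (take i ks) *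
    word_twist ((h * (\<Sum>j = 1..Suc r. a j)) *\<^sub>R \<omega>) (word_exp (b (Suc r) * h)) (drop i ks)"
proof -
  let ?n = "length ks" and ?c = "Suc r" and ?A = "\<Sum>j = 1..Suc r. a j"
  have js: "length js = i" "?c \<notin> set js" using assms(1) by (auto simp: step_lists_def)
  define l where "l = ?n - i"
  have n: "?n = i + l" using assms(2) by (simp add: l_def)
  have split_sum: "(\<Sum>k<?n. F k) = (\<Sum>k<i. F k) + (\<Sum>k<l. F (i + k))" for F :: "nat \<Rightarrow> real"
    unfolding n by (induction l) (simp_all add: add_ac)
  have split_prod: "(\<Prod>k<?n. F k) = (\<Prod>k<i. F k) * (\<Prod>k<l. F (i + k))" for F :: "nat \<Rightarrow> real"
    unfolding n by (induction l) (simp_all add: mult_ac)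
  let ?js = "js @ replicate l ?c"
  have nth: "?js ! k = js ! k" if "k < i" for k using that js by (simp add: nth_append)
  have nth': "?js ! (i + k) = ?c" if "k < l" for k using that js by (simp add: nth_append)
  have P: "(\<Prod>k<?n. b (?js ! k)) = (\<Prod>k<i. b (js ! k)) * b ?c ^ l"
    unfolding split_prod using nth nth' by simp
  have S: "(\<Sum>k<?n. (\<Sum>j = 1..?js ! k. a j) * idot (ks ! k) \<omega>) =
      (\<Sum>k<i. (\<Sum>j = 1..js ! k. a j) * idot (take i ks ! k) \<omega>) + ?A * (\<Sum>k\<leftarrow>drop i ks. idot k \<omega>)"
  proof -
    have "(\<Sum>k<l. ?A * idot (ks ! (i + k)) \<omega>) = ?A * (\<Sum>k\<leftarrow>drop i ks. idot k \<omega>)"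
      using assms(2) by (simp add: sum_list_sum_nth l_def lessThan_atLeast0 sum_distrib_left)
    then show ?thesis unfolding split_sum using nth nth' by simp
  qed
  have idot: "idot k (t *\<^sub>R \<omega>) = t * idot k \<omega>" for k t
    using linear_scale[OF bounded_linear.linear[OF bounded_linear_idot]] by simp
  have tw: "word_twist ((h * ?A) *\<^sub>R \<omega>) (word_exp (b ?c * h)) (drop i ks) =
    exp (\<i> * complex_of_real (h * ?A * (\<Sum>k\<leftarrow>drop i ks. idot k \<omega>))) * complex_of_real ((b ?c * h) ^ l / fact l)"
    by (simp add: word_twist_def word_exp_def idot sum_list_const_mult l_def)
  have "alpha_term \<omega> a b h ?js ks = complex_of_real (h ^ (i + l)) *
    (complex_of_real ((\<Prod>k<i. b (js ! k)) * b ?c ^ l / (real (sigma js) * fact l)) *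
     exp (\<i> * complex_of_real (((\<Sum>k<i. (\<Sum>j = 1..js ! k. a j) * idot (take i ks ! k) \<omega>) + ?A * (\<Sum>k\<leftarrow>drop i ks. idot k \<omega>)) * h)))"
    unfolding alpha_term_def P S sigma_append_replicate[OF js(2)] by (simp add: n)
  also have "\<dots> = alpha_term \<omega> a b h js (take i ks) *
    word_twist ((h * ?A) *\<^sub>R \<omega>) (word_exp (b ?c * h)) (drop i ks)"
    unfolding tw alpha_term_def using assms(2)
    by (simp add: min_absorb2 power_add power_mult_distrib distrib_left distrib_right exp_add mult_ac)
  finally show ?thesis by (simp only: l_def)
qed

lemma splitting_coeff_eq: "splitting_coeff \<omega> a b h r = alpha_tilde \<omega> a b r h"
proof (induction r)
  case 0
  have "step_lists 0 n = (if n = 0 then {[]} else {})" for n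
    by (auto simp: step_lists_def)
  then show ?case
    by (auto simp: fun_eq_iff alpha_tilde_eq word_unit_def alpha_term_def)
next
  case (Suc r)
  show ?case
  proof
    fix ks
    have "splitting_coeff \<omega> a b h (Suc r) ks = (\<Sum>i\<le>length ks. \<Sum>js\<in>step_lists r i.
      alpha_term \<omega> a b h js (take i ks) *
      word_twist ((h * (\<Sum>j = 1..Suc r. a j)) *\<^sub>R \<omega>) (word_exp (b (Suc r) * h)) (drop i ks))"
      by (simp add: Suc.IH word_conv_def alpha_tilde_eq min_absorb2 sum_distrib_right del: sum.cl_ivl_Suc)
    also have "\<dots> = alpha_tilde \<omega> a b (Suc r) h ks"
      unfolding alpha_tilde_eq step_lists_Suc
      by (intro sum.cong refl) (simp add: alpha_term_append del: sum.cl_ivl_Suc)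
    finally show "splitting_coeff \<omega> a b h (Suc r) ks = alpha_tilde \<omega> a b (Suc r) h ks" .
  qed
qed

section \<open>The expansion of the splitting integrator\<close>

theorem theorem2:
  fixes \<iota> :: "'d::finite \<Rightarrow> 'n::finite"
    and \<omega> :: "real ^ 'd"
    and f :: "real ^ 'n \<Rightarrow> real ^ 'n"
    and a b :: "nat \<Rightarrow> real"
    and r :: nat
    and h :: real
    and \<Phi>U \<Phi>P :: "real \<Rightarrow> ('d, 'n) formal_map"
  assumes "inj \<iota>"
    and "\<forall>j. 0 < \<omega> $ j"
    and "smooth_map f"
    and "angle_periodic \<iota> f"
    and "formal_flow (rotation_field \<iota> \<omega>) \<Phi>U"
    and "formal_flow (perturbation_field \<iota> f) \<Phi>P"
  shows "alpha_tilde \<omega> a b r h \<in> word_group \<and>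
    splitting_integrator \<Phi>U \<Phi>P a b h r =
      ext_word_series \<iota> f (cvec ((h * (\<Sum>j = 1..r. a j)) *\<^sub>R \<omega>)) (alpha_tilde \<omega> a b r h)"
  using splitting_coeff_group[of \<omega> a b h r]
    splitting_integrator_eq[OF assms(1,3,5,6), of a b h r]
  by (simp only: splitting_coeff_eq)

end
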